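(* Let $m\in\mathbb Z$, $q\in\mathcal K$, and let $(\overline{\mathcal{HV}},\varphi,\Delta_r)$ be the coboundary triangular Lie bialgebra related to the solution of CYBE $r=(x,0)\otimes(x^{m+1},qx^m)-(x^{m+1},qx^m)\otimes(x,0)$. Then its dual Lie bialgebra is $(\overline{\mathcal{HV}}{}^{\circ},[\cdot,\cdot],\Delta)$, where $\overline{\mathcal{HV}}{}^\circ=\mathcal A^\circ\oplus\mathcal A^\circ$, the cobracket $\Delta$ is determined by $$\Delta\big((\varepsilon^p,0)\big)=\sum_{i,j\in\mathbb Z,\ i+j=p+1}(j-i)(\varepsilon^i,0)\otimes(\varepsilon^j,0),\qquad \Delta\big((0,\varepsilon^p)\big)=\sum_{i,j\in\mathbb Z,\ i+j=p+1}\big(j(\varepsilon^i,0)\otimes(0,\varepsilon^j)-i(0,\varepsilon^i)\otimes(\varepsilon^j,0)\big)\quad(p\in\mathbb Z),$$ and the bracket is uniquely determined by (for $i,j\in\mathbb Z$): (1) $[(\varepsilon^i,0),(\varepsilon^j,0)]=\begin{cases}(2m-j+1)(\varepsilon^{j-m},0)&\text{if } i=1,\ j\neq1,\\ (j-1)(\varepsilon^j,0)&\text{if } i=m+1,\ j\neq1,\,m+1,\\ 0&\text{if } i,j\notin\{1,m+1\};\end{cases}$ (2) $[(\varepsilon^i,0),(0,\varepsilon^j)]=\begin{cases}mq(\varepsilon^{j-m+1},0)-(j-m)(0,\varepsilon^{j-m})&\text{if } i=1,\ m\neq0,\\ -mq(\varepsilon^{m+1},0)+m(0,\varepsilon^m)&\text{if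 } i=m+1,\ j=m,\\ j(0,\varepsilon^j)&\text{if } i=m+1,\ j\neq m,\\ (1-i)q(\varepsilon^i,0)&\text{if } i\neq1,\,m+1,\ j=m,\\ 0&\text{otherwise};\end{cases}$ (3) $[(0,\varepsilon^i),(0,\varepsilon^j)]=\begin{cases}jq(0,\varepsilon^j)&\text{if } i=m,\ j\neq m,\\ 0&\text{if } i\neq m,\ j\neq m.\end{cases}$
   Context: $\mathcal K$ is an algebraically closed field of characteristic zero, $\mathcal A=\mathcal K[x^{\pm1}]$, $\partial=\frac{d}{dx}$. $\overline{\mathcal{HV}}=\mathcal A\oplus\mathcal A$ is the centerless twisted Heisenberg-Virasoro algebra with Lie bracket $\varphi=[\cdot,\cdot]$, $[(f_1,f_2),(g_1,g_2)]=(f_1\partial g_1-g_1\partial f_1,\ f_1\partial g_2-g_1\partial f_2)$; with $L_k=(x^{k+1},0)$, $I_n=(0,x^n)$ this reads $[L_k,L_n]=(n-k)L_{k+n}$, $[I_k,I_n]=0$, $[L_k,I_n]=nI_{k+n}$. A Lie bialgebra is a Lie algebra $\mathcal L$ with a Lie cobracket $\delta:\mathcal L\to\mathcal L\otimes\mathcal L$ such that $\delta[x,y]=x\cdot\delta(y)-y\cdot\delta(x)$, where $x\cdot(y\otimes z)=[x,y]\otimes z+y\otimes[x,z]$. For $r=\sum r^{[1]}\otimes r^{[2]}\in\mathcal L\otimes\mathcal L$ put $\Delta_r(z)=z\cdot r$; the bialgebra is coboundary triangular if its cobracket is $\Delta_r$ with $r$ satisfying the classical Yang-Baxter equation (CYBE)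 $[r_{12},r_{13}]+[r_{12},r_{23}]+[r_{13},r_{23}]=0$, where $r_{12}=\sum r^{[1]}\otimes r^{[2]}\otimes1$, $r_{13}=\sum r^{[1]}\otimes1\otimes r^{[2]}$, $r_{23}=\sum1\otimes r^{[1]}\otimes r^{[2]}$ in the third tensor power of the universal enveloping algebra of $\mathcal L$. $\varphi^*:\overline{\mathcal{HV}}{}^*\to(\overline{\mathcal{HV}}\otimes\overline{\mathcal{HV}})^*$ is the dual of the bracket; $\overline{\mathcal{HV}}{}^{\circ}$ is the maximal good subspace of $\overline{\mathcal{HV}}{}^*$, i.e. the sum of all subspaces $U$ with $\varphi^*(U)\subset U\otimes U$. It equals $\mathcal A^\circ\oplus\mathcal A^\circ$ with $\mathcal A^\circ=\{\sum_{i\in\mathbb Z}f_i\varepsilon^i\in\mathcal A^*\mid \exists\, s\in\mathbb N,\ c_1,\dots,c_s\in\mathcal K:\ f_n=\sum_{j=1}^s c_jf_{n-j}\ \forall n\in\mathbb Z\}$. The dual Lie bialgebra of a Lie bialgebra $(\overline{\mathcal{HV}},\varphi,\delta)$ is $\overline{\mathcal{HV}}{}^\circ$ with bracket and cobracket dual to $\delta$ and $\varphi$: $\langle[f,h],\xi\rangle=\langle f\otimes h,\delta(\xi)\rangle$ and $\langle\Delta f,\xi\otimes\eta\rangle=\langle f,[\xi,\eta]\rangle$ for $f,h\in\overline{\mathcal{HV}}{}^\circ$, $\xi,\eta\in\overline{\mathcal{HV}}$. $\varepsilon^i\in\mathcal A^*$ is given by $\varepsilon^i(x^j)=\delta_{i,j}$;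 every $f\in\mathcal A^*$ is written as a formal (possibly infinite) sum $\sum_j f_j\varepsilon^j$, $f_j=f(x^j)$. $(\varepsilon^i,0)(x^k,x^l)=\delta_{i,k}$, $(0,\varepsilon^i)(x^k,x^l)=\delta_{i,l}$. Infinite sums denote functionals evaluated termwise; the formulas on the $\varepsilon^i$ are formulas for the dual maps $\varphi^*$ and $(f,h)\mapsto(f\otimes h)\circ\delta$ on these functionals, and the structure on $\overline{\mathcal{HV}}{}^\circ$ is obtained by extending them to formal infinite linear combinations (remaining brackets following from skew-symmetry).
   Formalization: For m=0 the printed rows i=1 and i=m+1 of (1) contradict each other, and row i=m+1, j≠m of (2) is false; these three rows are stated only for m≠0, and for m=0 the brackets [(ε^1,0),(ε^j,0)] and [(ε^1,0),(0,ε^j)] are stated to be 0. *)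

theory Defs
  imports
    "HOL-Computational_Algebra.Polynomial"
    "HOL-Library.Poly_Mapping"
    "HOL-Library.Product_Plus"
    "HOL-Library.Function_Algebras"
begin

section \<open>Tensors over a subspace\<close>

text \<open>
  Throughout, \<open>V\<close> is (the carrier of) a subspace of a vector space with scalar multiplication \<open>s\<close>.
\<close>

definition linear_form :: "('k::field \<Rightarrow> 'v \<Rightarrow> 'v::ab_group_add) \<Rightarrow> 'v set \<Rightarrow> ('v \<Rightarrow> 'k) \<Rightarrow> bool" where
  "linear_form s V f \<longleftrightarrow>
     (\<forall>x\<in>V. \<forall>y\<in>V. f (x + y) = f x + f y) \<and> (\<forall>c. \<forall>x\<in>V. f (s c x) = c * f x)"

definition bilinear_form ::
  "('k::field \<Rightarrow> 'v \<Rightarrow> 'v::ab_group_add) \<Rightarrow> 'v set \<Rightarrow> ('v \<Rightarrow> 'v \<Rightarrow> 'k) \<Rightarrow> bool" where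
  "bilinear_form s V B \<longleftrightarrow>
     (\<forall>z\<in>V. linear_form s V (\<lambda>x. B x z) \<and> linear_form s V (\<lambda>x. B z x))"

definition trilinear_form ::
  "('k::field \<Rightarrow> 'v \<Rightarrow> 'v::ab_group_add) \<Rightarrow> 'v set \<Rightarrow> ('v \<Rightarrow> 'v \<Rightarrow> 'v \<Rightarrow> 'k) \<Rightarrow> bool" where
  "trilinear_form s V T \<longleftrightarrow>
     (\<forall>y\<in>V. \<forall>z\<in>V. linear_form s V (\<lambda>x. T x y z) \<and> linear_form s V (\<lambda>x. T y x z)
        \<and> linear_form s V (\<lambda>x. T y z x))"

text \<open>
  The bilinear forms on \<open>V\<close> are the dual space of \<open>V \<otimes> V\<close> and separate its points.  So a tensor is
  encoded as a functional on bilinear forms: \<open>x \<otimes> y\<close> is \<open>B \<mapsto> B x y\<close>, and a linear map out of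
  \<open>V \<otimes> V\<close> given on pure tensors is evaluated on \<open>t\<close> by \<open>t (\<lambda>x y. \<dots>)\<close>.  The value on arguments
  that are not bilinear is fixed to 0, so that equality of functions is equality of tensors.
  Scalars are absorbed in the factors, so finite sums of pure tensors, given by lists of
  pairs, exhaust \<open>V \<otimes> V\<close>.
\<close>

type_synonym ('k, 'v) tensor2 = "('v \<Rightarrow> 'v \<Rightarrow> 'k) \<Rightarrow> 'k"

definition tensor_of ::
  "('k::field \<Rightarrow> 'v \<Rightarrow> 'v::ab_group_add) \<Rightarrow> 'v set \<Rightarrow> ('v \<times> 'v) list \<Rightarrow> ('k, 'v) tensor2" where
  "tensor_of s V r = (\<lambda>B. if bilinear_form s V B then (\<Sum>(x, y)\<leftarrow>r. B x y) else 0)"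

definition tensor_square ::
  "('k::field \<Rightarrow> 'v \<Rightarrow> 'v::ab_group_add) \<Rightarrow> 'v set \<Rightarrow> ('k, 'v) tensor2 set" where
  "tensor_square s V = {tensor_of s V r |r. set r \<subseteq> V \<times> V}"

text \<open>The action \<open>z \<cdot> (x \<otimes> y) = [z,x] \<otimes> y + x \<otimes> [z,y]\<close>.\<close>

definition tensor_act ::
  "('k::field \<Rightarrow> 'v \<Rightarrow> 'v::ab_group_add) \<Rightarrow> 'v set \<Rightarrow> ('v \<Rightarrow> 'v \<Rightarrow> 'v)
    \<Rightarrow> 'v \<Rightarrow> ('k, 'v) tensor2 \<Rightarrow> ('k, 'v) tensor2" where
  "tensor_act s V br z t =
     (\<lambda>B. if bilinear_form s V B then t (\<lambda>x y. B (br z x) y + B x (br z y)) else 0)"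


section \<open>Lie bialgebras\<close>

definition lie_algebra ::
  "('k::field \<Rightarrow> 'v \<Rightarrow> 'v::ab_group_add) \<Rightarrow> 'v set \<Rightarrow> ('v \<Rightarrow> 'v \<Rightarrow> 'v) \<Rightarrow> bool" where
  "lie_algebra s V br \<longleftrightarrow>
     vector_space s \<and> module.subspace s V \<and>
     (\<forall>x\<in>V. \<forall>y\<in>V. br x y \<in> V) \<and>
     (\<forall>x\<in>V. \<forall>y\<in>V. \<forall>z\<in>V. br (x + y) z = br x z + br y z \<and> br z (x + y) = br z x + br z y) \<and>
     (\<forall>c. \<forall>x\<in>V. \<forall>y\<in>V. br (s c x) y = s c (br x y) \<and> br x (s c y) = s c (br x y)) \<and>
     (\<forall>x\<in>V. br x x = 0) \<and>
     (\<forall>x\<in>V. \<forall>y\<in>V. \<forall>z\<in>V. br x (br y z) + br y (br z x) + br z (br x y) = 0)"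

text \<open>
  The last two conditions are skew-symmetry of \<open>\<delta> x\<close> and the co-Jacobi identity: \<open>(id \<otimes> \<delta>) (\<delta> x)\<close>,
  as a functional on trilinear forms, vanishes after summing over the cyclic permutations of
  the three tensor factors.
\<close>

definition lie_coalgebra ::
  "('k::field \<Rightarrow> 'v \<Rightarrow> 'v::ab_group_add) \<Rightarrow> 'v set \<Rightarrow> ('v \<Rightarrow> ('k, 'v) tensor2) \<Rightarrow> bool" where
  "lie_coalgebra s V \<delta> \<longleftrightarrow>
     vector_space s \<and> module.subspace s V \<and>
     (\<forall>x\<in>V. \<delta> x \<in> tensor_square s V) \<and>
     (\<forall>B. bilinear_form s V B \<longrightarrow> linear_form s V (\<lambda>x. \<delta> x B)) \<and>
     (\<forall>x\<in>V. \<forall>B. bilinear_form s V B \<longrightarrow> \<delta> x (\<lambda>u v. B v u) = - \<delta> x B) \<and>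
     (\<forall>x\<in>V. \<forall>T. trilinear_form s V T \<longrightarrow>
        \<delta> x (\<lambda>u v. \<delta> v (\<lambda>w z. T u w z + T w z u + T z u w)) = 0)"

definition lie_bialgebra ::
  "('k::field \<Rightarrow> 'v \<Rightarrow> 'v::ab_group_add) \<Rightarrow> 'v set \<Rightarrow> ('v \<Rightarrow> 'v \<Rightarrow> 'v)
    \<Rightarrow> ('v \<Rightarrow> ('k, 'v) tensor2) \<Rightarrow> bool" where
  "lie_bialgebra s V br \<delta> \<longleftrightarrow>
     lie_algebra s V br \<and> lie_coalgebra s V \<delta> \<and>
     (\<forall>x\<in>V. \<forall>y\<in>V. \<delta> (br x y) = tensor_act s V br x (\<delta> y) - tensor_act s V br y (\<delta> x))"


section \<open>The classical Yang-Baxter equation\<close>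

text \<open>
  The third tensor power of the universal enveloping algebra of a Lie algebra (whose carrier is
  a whole type) is a quotient of the third tensor power of the free associative algebra on its
  elements; the latter is the algebra of the monoid of triples of words.
\<close>

datatype 'v words = Words "'v list"

instantiation words :: (type) monoid_add
begin

definition zero_words :: "'v words" where
  "zero_words = Words []"

fun plus_words :: "'v words \<Rightarrow> 'v words \<Rightarrow> 'v words" where
  "plus_words (Words xs) (Words ys) = Words (xs @ ys)"

instance
proof
  fix a b c :: "'v words"
  show "a + b + c = a + (b + c)" by (cases a; cases b; cases c) simp
  show "0 + a = a" by (cases a) (simp add: zero_words_def)
  show "a + 0 = a" by (cases a) (simp add: zero_words_def)
qed

end

type_synonym ('k, 'v) free_cube = "('v words \<times> 'v words \<times> 'v words) \<Rightarrow>\<^sub>0 'k"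

definition slot1 :: "'v \<Rightarrow> ('k::field, 'v) free_cube" where
  "slot1 x = Poly_Mapping.single (Words [x], 0, 0) 1"

definition slot2 :: "'v \<Rightarrow> ('k::field, 'v) free_cube" where
  "slot2 x = Poly_Mapping.single (0, Words [x], 0) 1"

definition slot3 :: "'v \<Rightarrow> ('k::field, 'v) free_cube" where
  "slot3 x = Poly_Mapping.single (0, 0, Words [x]) 1"

definition uea_relators ::
  "('k::field \<Rightarrow> 'v \<Rightarrow> 'v::ab_group_add) \<Rightarrow> ('v \<Rightarrow> 'v \<Rightarrow> 'v)
    \<Rightarrow> ('v \<Rightarrow> ('k, 'v) free_cube) \<Rightarrow> ('k, 'v) free_cube set" where
  "uea_relators s br w =
     {w (x + y) - w x - w y |x y. True} \<union>
     {w (s c x) - Poly_Mapping.single 0 c * w x |c x. True} \<union>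
     {w x * w y - w y * w x - w (br x y) |x y. True}"

inductive_set two_sided_ideal :: "'a::ring_1 set \<Rightarrow> 'a set" for S where
  zero: "0 \<in> two_sided_ideal S"
| add: "a \<in> two_sided_ideal S \<Longrightarrow> b \<in> two_sided_ideal S \<Longrightarrow> a + b \<in> two_sided_ideal S"
| gen: "g \<in> S \<Longrightarrow> u * g * v \<in> two_sided_ideal S"

definition uea_cube_ideal ::
  "('k::field \<Rightarrow> 'v \<Rightarrow> 'v::ab_group_add) \<Rightarrow> ('v \<Rightarrow> 'v \<Rightarrow> 'v) \<Rightarrow> ('k, 'v) free_cube set" where
  "uea_cube_ideal s br =
     two_sided_ideal (uea_relators s br slot1 \<union> uea_relators s br slot2 \<union> uea_relators s br slot3)"

definition cybe ::
  "('k::field \<Rightarrow> 'v \<Rightarrow> 'v::ab_group_add) \<Rightarrow> ('v \<Rightarrow> 'v \<Rightarrow> 'v) \<Rightarrow> ('v \<times> 'v) list \<Rightarrow> bool" where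
  "cybe s br r \<longleftrightarrow>
     (let r12 = (\<Sum>(x, y)\<leftarrow>r. slot1 x * slot2 y);
          r13 = (\<Sum>(x, y)\<leftarrow>r. slot1 x * slot3 y);
          r23 = (\<Sum>(x, y)\<leftarrow>r. slot2 x * slot3 y);
          comm = (\<lambda>a b. a * b - b * a)
      in comm r12 r13 + comm r12 r23 + comm r13 r23 \<in> uea_cube_ideal s br)"

definition coboundary ::
  "('k::field \<Rightarrow> 'v \<Rightarrow> 'v::ab_group_add) \<Rightarrow> ('v \<Rightarrow> 'v \<Rightarrow> 'v) \<Rightarrow> ('v \<times> 'v) list
    \<Rightarrow> 'v \<Rightarrow> ('k, 'v) tensor2" where
  "coboundary s br r z = tensor_act s UNIV br z (tensor_of s UNIV r)"

definition coboundary_triangular ::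
  "('k::field \<Rightarrow> 'v \<Rightarrow> 'v::ab_group_add) \<Rightarrow> ('v \<Rightarrow> 'v \<Rightarrow> 'v) \<Rightarrow> ('v \<times> 'v) list \<Rightarrow> bool" where
  "coboundary_triangular s br r \<longleftrightarrow>
     lie_bialgebra s UNIV br (coboundary s br r) \<and> cybe s br r"


section \<open>The centerless twisted Heisenberg-Virasoro algebra\<close>

text \<open>
  Laurent polynomials are the group algebra of the integers; multiplication is convolution.
\<close>

type_synonym 'k laurent = "int \<Rightarrow>\<^sub>0 'k"

type_synonym 'k hv = "'k laurent \<times> 'k laurent"

abbreviation xpow :: "int \<Rightarrow> 'k::field laurent" where
  "xpow n \<equiv> Poly_Mapping.single n 1"

definition laurent_scale :: "'k::field \<Rightarrow> 'k laurent \<Rightarrow> 'k laurent" where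
  "laurent_scale c = Poly_Mapping.map ((*) c)"

definition laurent_deriv :: "'k::field laurent \<Rightarrow> 'k laurent" where
  "laurent_deriv f =
     (\<Sum>n\<in>Poly_Mapping.keys f. Poly_Mapping.single (n - 1) (of_int n * Poly_Mapping.lookup f n))"

fun hv_scale :: "'k::field \<Rightarrow> 'k hv \<Rightarrow> 'k hv" where
  "hv_scale c (f, g) = (laurent_scale c f, laurent_scale c g)"

fun hv_bracket :: "'k::field hv \<Rightarrow> 'k hv \<Rightarrow> 'k hv" where
  "hv_bracket (f1, f2) (g1, g2) =
     (f1 * laurent_deriv g1 - g1 * laurent_deriv f1, f1 * laurent_deriv g2 - g1 * laurent_deriv f2)"

definition hv_r :: "int \<Rightarrow> 'k::field \<Rightarrow> ('k hv \<times> 'k hv) list" where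
  "hv_r m q =
     [((xpow 1, 0), (xpow (m + 1), laurent_scale q (xpow m))),
      (- (xpow (m + 1), laurent_scale q (xpow m)), (xpow 1, 0))]"


section \<open>The dual Lie bialgebra\<close>

definition dual_scale :: "'k::field \<Rightarrow> ('v \<Rightarrow> 'k) \<Rightarrow> 'v \<Rightarrow> 'k" where
  "dual_scale c f = (\<lambda>\<xi>. c * f \<xi>)"

definition hv_dual :: "('k::field hv \<Rightarrow> 'k) set" where
  "hv_dual = {f. Vector_Spaces.linear hv_scale (*) f}"

text \<open>
  Elements of the dual of \<open>HV \<otimes> HV\<close> are treated as bilinear forms.  For functionals \<open>f\<close>, \<open>h\<close>
  and \<open>t \<in> HV \<otimes> HV\<close>, \<open>pair_tensor f h t\<close> is \<open>\<langle>f \<otimes> h, t\<rangle>\<close>; for \<open>t \<in> U \<otimes> U\<close> with \<open>U\<close> a space of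
  functionals, \<open>eval_tensor t \<xi> \<eta>\<close> is \<open>\<langle>t, \<xi> \<otimes> \<eta>\<rangle>\<close>.
\<close>

definition pair_tensor :: "('v \<Rightarrow> 'k::field) \<Rightarrow> ('v \<Rightarrow> 'k) \<Rightarrow> ('k, 'v) tensor2 \<Rightarrow> 'k" where
  "pair_tensor f h t = t (\<lambda>x y. f x * h y)"

definition eval_tensor :: "('k::field, 'v \<Rightarrow> 'k) tensor2 \<Rightarrow> 'v \<Rightarrow> 'v \<Rightarrow> 'k" where
  "eval_tensor t \<xi> \<eta> = t (\<lambda>g h. g \<xi> * h \<eta>)"

text \<open>The dual \<open>\<phi>\<^sup>*\<close> of the bracket, and the dual of a cobracket.\<close>

definition bracket_dual :: "('k::field hv \<Rightarrow> 'k) \<Rightarrow> 'k hv \<Rightarrow> 'k hv \<Rightarrow> 'k" where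
  "bracket_dual f \<xi> \<eta> = f (hv_bracket \<xi> \<eta>)"

definition cobracket_dual ::
  "('v \<Rightarrow> ('k::field, 'v) tensor2) \<Rightarrow> ('v \<Rightarrow> 'k) \<Rightarrow> ('v \<Rightarrow> 'k) \<Rightarrow> 'v \<Rightarrow> 'k" where
  "cobracket_dual \<delta> f h \<xi> = pair_tensor f h (\<delta> \<xi>)"

definition good_subspace :: "('k::field hv \<Rightarrow> 'k) set \<Rightarrow> bool" where
  "good_subspace U \<longleftrightarrow>
     module.subspace dual_scale U \<and> U \<subseteq> hv_dual \<and>
     (\<forall>f\<in>U. \<exists>t\<in>tensor_square dual_scale U. eval_tensor t = bracket_dual f)"

definition hv_circ :: "('k::field hv \<Rightarrow> 'k) set" where
  "hv_circ = module.span dual_scale (\<Union>{U. good_subspace U})"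

definition dual_lie_bialgebra ::
  "('k::field hv \<Rightarrow> ('k, 'k hv) tensor2)
    \<Rightarrow> (('k hv \<Rightarrow> 'k) \<Rightarrow> ('k hv \<Rightarrow> 'k) \<Rightarrow> 'k hv \<Rightarrow> 'k)
    \<Rightarrow> (('k hv \<Rightarrow> 'k) \<Rightarrow> ('k, 'k hv \<Rightarrow> 'k) tensor2) \<Rightarrow> bool" where
  "dual_lie_bialgebra \<delta> br \<Delta> \<longleftrightarrow>
     lie_bialgebra dual_scale hv_circ br \<Delta> \<and>
     (\<forall>f\<in>hv_circ. \<forall>h\<in>hv_circ. br f h = cobracket_dual \<delta> f h) \<and>
     (\<forall>f\<in>hv_circ. eval_tensor (\<Delta> f) = bracket_dual f)"

definition laurent_circ :: "('k::field laurent \<Rightarrow> 'k) set" where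
  "laurent_circ =
     {f. Vector_Spaces.linear laurent_scale (*) f \<and>
         (\<exists>(s::nat) c. \<forall>n::int. f (xpow n) = (\<Sum>j=1..s. c j * f (xpow (n - int j))))}"

definition pair_dual ::
  "('k::field laurent \<Rightarrow> 'k) \<Rightarrow> ('k laurent \<Rightarrow> 'k) \<Rightarrow> 'k hv \<Rightarrow> 'k" where
  "pair_dual f g = (\<lambda>(a, b). f a + g b)"

definition eps :: "int \<Rightarrow> 'k::field laurent \<Rightarrow> 'k" where
  "eps i a = Poly_Mapping.lookup a i"

definition eps1 :: "int \<Rightarrow> 'k::field hv \<Rightarrow> 'k" where
  "eps1 i = pair_dual (eps i) (\<lambda>_. 0)"

definition eps2 :: "int \<Rightarrow> 'k::field hv \<Rightarrow> 'k" where
  "eps2 i = pair_dual (\<lambda>_. 0) (eps i)"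

text \<open>
  Indices \<open>Inl i\<close> and \<open>Inr i\<close> stand for the first and second summand, so a functional \<open>f\<close> on
  \<open>HV\<close> is the formal sum of all \<open>f (hv_mon a)\<close> times \<open>hv_eps a\<close>.
\<close>

fun hv_mon :: "int + int \<Rightarrow> 'k::field hv" where
  "hv_mon (Inl i) = (xpow i, 0)"
| "hv_mon (Inr i) = (0, xpow i)"

fun hv_eps :: "int + int \<Rightarrow> 'k::field hv \<Rightarrow> 'k" where
  "hv_eps (Inl i) = eps1 i"
| "hv_eps (Inr i) = eps2 i"

text \<open>
  A formal infinite sum of functionals is evaluated termwise; at each argument only finitely
  many terms may be nonzero.
\<close>

definition termwise_sum :: "('i \<Rightarrow> 'k::comm_monoid_add) \<Rightarrow> 'i set \<Rightarrow> 'k \<Rightarrow> bool" where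
  "termwise_sum F I v \<longleftrightarrow> finite {i\<in>I. F i \<noteq> 0} \<and> v = sum F {i\<in>I. F i \<noteq> 0}"

text \<open>
  The brackets of the functionals \<open>\<epsilon>\<^sup>i\<close>, as a table \<open>c\<close> indexed by \<open>int + int\<close>.  For \<open>m = 0\<close> the
  rows for \<open>i = 1\<close> and \<open>i = m + 1\<close> would collide with incompatible values; in that case
  \<open>r\<close> is a multiple of \<open>L\<^sub>0 \<otimes> I\<^sub>0 - I\<^sub>0 \<otimes> L\<^sub>0\<close> and all brackets with \<open>(\<epsilon>\<^sup>1, 0)\<close> are zero.  This
  accounts for the conditions on \<open>m\<close> in the first two blocks.
\<close>

definition bracket_table ::
  "int \<Rightarrow> 'k::field \<Rightarrow> (int + int \<Rightarrow> int + int \<Rightarrow> 'k hv \<Rightarrow> 'k) \<Rightarrow> bool" where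
  "bracket_table m q c \<longleftrightarrow>
    (\<forall>i j.
      (m \<noteq> 0 \<and> i = 1 \<and> j \<noteq> 1 \<longrightarrow>
         c (Inl i) (Inl j) = (\<lambda>\<xi>. of_int (2 * m - j + 1) * eps1 (j - m) \<xi>)) \<and>
      (m \<noteq> 0 \<and> i = m + 1 \<and> j \<noteq> 1 \<and> j \<noteq> m + 1 \<longrightarrow>
         c (Inl i) (Inl j) = (\<lambda>\<xi>. of_int (j - 1) * eps1 j \<xi>)) \<and>
      (i \<notin> {1, m + 1} \<and> j \<notin> {1, m + 1} \<longrightarrow> c (Inl i) (Inl j) = (\<lambda>\<xi>. 0)) \<and>
      (m = 0 \<and> i = 1 \<longrightarrow> c (Inl i) (Inl j) = (\<lambda>\<xi>. 0))) \<and>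
    (\<forall>i j.
      c (Inl i) (Inr j) =
        (if i = 1 \<and> m \<noteq> 0 then
           (\<lambda>\<xi>. of_int m * q * eps1 (j - m + 1) \<xi> - of_int (j - m) * eps2 (j - m) \<xi>)
         else if i = m + 1 \<and> j = m then
           (\<lambda>\<xi>. - of_int m * q * eps1 (m + 1) \<xi> + of_int m * eps2 m \<xi>)
         else if i = m + 1 \<and> j \<noteq> m \<and> m \<noteq> 0 then
           (\<lambda>\<xi>. of_int j * eps2 j \<xi>)
         else if i \<notin> {1, m + 1} \<and> j = m then
           (\<lambda>\<xi>. of_int (1 - i) * q * eps1 i \<xi>)
         else (\<lambda>\<xi>. 0))) \<and>
    (\<forall>i j.
      (i = m \<and> j \<noteq> m \<longrightarrow> c (Inr i) (Inr j) = (\<lambda>\<xi>. of_int j * q * eps2 j \<xi>)) \<and>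
      (i \<noteq> m \<and> j \<noteq> m \<longrightarrow> c (Inr i) (Inr j) = (\<lambda>\<xi>. 0)))"

end

theory Submission
  imports Defs
begin

text \<open>
  Write \<open>a = (x, 0)\<close> and \<open>b = (x\<^sup>m\<^sup>+\<^sup>1, q x\<^sup>m)\<close>, so that \<open>r = a \<otimes> b - b \<otimes> a\<close>.  Since \<open>[a, b] = m b\<close>, the
  two elements span a subalgebra of dimension at most two, and for such a subalgebra the
  Yang-Baxter equation and the axioms of a coboundary Lie bialgebra are checked by expansion
  (\<open>cybe_wedge\<close>, \<open>lie_bialgebra_wedge\<close>).

  The maximal good subspace is found through Hankel ranks.  A sequence \<open>F\<close> indexed by the integers
  is linearly recurrent iff the matrix \<open>F (i + j)\<close> has finite rank
  (\<open>linear_recurrent_iff_hankel_finite\<close>).  If \<open>f\<close> lies in a good subspace, then \<open>f [\<xi>, \<eta>]\<close> is a bilinear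
  form of finite rank, and its values on monomials are \<open>(j - i) F (i + j - 1)\<close> and
  \<open>j G (i + j - 1)\<close>, where \<open>F\<close> and \<open>G\<close> are the coefficient sequences of \<open>f\<close>.  Moving one step along an
  antidiagonal changes the factors \<open>j - i\<close> and \<open>j\<close> by a nonzero constant, so \<open>F\<close> and \<open>G\<close> have finite
  Hankel rank themselves (\<open>good_subspace_recurrent\<close>).  Conversely, the shifts of a recurrent sequence
  span a finite-dimensional space of recurrent sequences, and multiplication by the index preserves
  recurrence, so the recurrent functionals form a good subspace (\<open>good_subspace_hv_recurrent\<close>).

  The tool that makes the tensors over a function space manageable is interpolation
  (\<open>ex_interpolation\<close>): in a finite-dimensional space of functions there are finitely many points
  \<open>p\<close> and functions \<open>k\<close> such that every \<open>v\<close> in it is the sum of all \<open>v p\<close> times \<open>k\<close>.  It splits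
  \<open>F (i + j)\<close> into recurrent factors, and it shows that a tensor of functionals is determined by its
  values at pairs of points (\<open>tensor_square_eqI\<close>).  With this, the axioms of the dual Lie bialgebra are
  the transposes of those of the given one (\<open>lie_bialgebra_dual\<close>).

  The formulas follow from the expansion of a functional in the \<open>\<epsilon>\<^sup>i\<close>
  (\<open>hv_expand\<close>) and from evaluating the coordinate functionals at \<open>a\<close>, \<open>b\<close>, \<open>[\<xi>, a]\<close> and \<open>[\<xi>, b]\<close>
  (\<open>hv_eps_r\<close>).
\<close>

section \<open>Finite-dimensional spaces of functions\<close>

lemma vector_space_dual_scale: "vector_space (dual_scale :: 'k::field \<Rightarrow> ('v \<Rightarrow> 'k) \<Rightarrow> _)"
  by unfold_locales (auto simp: dual_scale_def fun_eq_iff algebra_simps)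

lemma module_dual_scale: "module (dual_scale :: 'k::field \<Rightarrow> ('v \<Rightarrow> 'k) \<Rightarrow> _)"
  using vector_space_dual_scale by (simp add: module_iff_vector_space)

lemma subspace_dual_scale_iff:
  fixes V :: "('v \<Rightarrow> 'k::field) set"
  shows "module.subspace dual_scale V \<longleftrightarrow>
     (\<lambda>_. 0) \<in> V \<and> (\<forall>f\<in>V. \<forall>g\<in>V. (\<lambda>x. f x + g x) \<in> V) \<and> (\<forall>c. \<forall>f\<in>V. (\<lambda>x. c * f x) \<in> V)"
  by (simp add: module.subspace_def[OF module_dual_scale] plus_fun_def zero_fun_def dual_scale_def
      Ball_def)

lemma subspace_dual_scaleD:
  fixes V :: "('v \<Rightarrow> 'k::field) set"
  assumes "module.subspace dual_scale V"
  shows "(\<lambda>_. 0) \<in> V" "f \<in> V \<Longrightarrow> g \<in> V \<Longrightarrow> (\<lambda>x. f x + g x) \<in> V" "f \<in> V \<Longrightarrow> (\<lambda>x. c * f x) \<in> V"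
    "f \<in> V \<Longrightarrow> g \<in> V \<Longrightarrow> (\<lambda>x. f x - g x) \<in> V" "f \<in> V \<Longrightarrow> (\<lambda>x. - f x) \<in> V"
proof -
  note A = assms[unfolded subspace_dual_scale_iff]
  show "(\<lambda>_. 0) \<in> V" "f \<in> V \<Longrightarrow> g \<in> V \<Longrightarrow> (\<lambda>x. f x + g x) \<in> V" "f \<in> V \<Longrightarrow> (\<lambda>x. c * f x) \<in> V"
    using A by auto
  have neg: "(\<lambda>x. - g x) \<in> V" if "g \<in> V" for g
    using A[THEN conjunct2, THEN conjunct2, rule_format, OF that, of "-1"] by simp
  show "f \<in> V \<Longrightarrow> (\<lambda>x. - f x) \<in> V" by (rule neg)
  show "(\<lambda>x. f x - g x) \<in> V" if "f \<in> V" "g \<in> V"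
    using A[THEN conjunct2, THEN conjunct1, rule_format, OF that(1) neg[OF that(2)]] by simp
qed

lemma subspace_sum_list:
  fixes V :: "('v \<Rightarrow> 'k::field) set"
  assumes "module.subspace dual_scale V" "\<And>a. a \<in> set as \<Longrightarrow> F a \<in> V"
  shows "(\<lambda>x. \<Sum>a\<leftarrow>as. F a x) \<in> V"
  using assms(2)
proof (induction as)
  case Nil
  then show ?case using subspace_dual_scaleD(1)[OF assms(1)] by simp
next
  case (Cons a as)
  then show ?case using subspace_dual_scaleD(2)[OF assms(1), of "F a" "\<lambda>x. \<Sum>a\<leftarrow>as. F a x"] by simp
qed

text \<open>
  Point evaluations separate the elements of a function space, so a finite-dimensional space of
  functions has a reproducing formula: finitely many points \<open>p\<close> with functions \<open>k\<close> in the
  space, such that every \<open>v\<close> in the space is the sum of all \<open>v p\<close> times \<open>k\<close>.  The points and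
  functions are given by a list of pairs.
\<close>

definition interpolate :: "('x \<times> ('x \<Rightarrow> 'k::field)) list \<Rightarrow> ('x \<Rightarrow> 'k) \<Rightarrow> 'x \<Rightarrow> 'k" where
  "interpolate ps u = (\<lambda>x. \<Sum>(p, k)\<leftarrow>ps. u p * k x)"

lemma interpolate_add:
  "interpolate ps (\<lambda>x. u x + v x) = (\<lambda>x. interpolate ps u x + interpolate ps v x)"
  by (induction ps) (auto simp: interpolate_def fun_eq_iff algebra_simps)

lemma interpolate_scale:
  "interpolate ps (\<lambda>x. c * u x) = (\<lambda>x. c * interpolate ps u x)"
  by (induction ps) (auto simp: interpolate_def fun_eq_iff algebra_simps)

lemma interpolate_in_subspace:
  assumes "module.subspace dual_scale V" "snd ` set ps \<subseteq> V"
  shows "interpolate ps u \<in> V"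
  unfolding interpolate_def split_def
  by (rule subspace_sum_list[OF assms(1)]) (use assms in \<open>auto intro!: subspace_dual_scaleD(3)\<close>)

lemma ex_interpolation:
  fixes V :: "('x \<Rightarrow> 'k::field) set"
  assumes V: "module.subspace dual_scale V" and gs: "set gs \<subseteq> V"
  shows "\<exists>ps. snd ` set ps \<subseteq> V \<and> (\<forall>v\<in>set gs. interpolate ps v = v)"
  using gs
proof (induction gs)
  case Nil
  show ?case by (rule exI[of _ "[]"]) simp
next
  case (Cons w gs)
  then obtain ps where ps: "snd ` set ps \<subseteq> V" "\<And>v. v \<in> set gs \<Longrightarrow> interpolate ps v = v"
    by auto
  define w' where "w' = (\<lambda>x. w x - interpolate ps w x)"
  have w'V: "w' \<in> V"
    unfolding w'_def using Cons.prems ps(1)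
    by (intro subspace_dual_scaleD(4)[OF V] interpolate_in_subspace[OF V]) auto
  show ?case
  proof (cases "\<exists>p. w' p \<noteq> 0")
    case False
    then have "interpolate ps w = w" by (auto simp: w'_def fun_eq_iff)
    then show ?thesis using ps by (intro exI[of _ ps]) auto
  next
    case True
    then obtain p where p: "w' p \<noteq> 0" ..
    \<comment> \<open>one new point, together with a rank-one correction that vanishes on the old functions\<close>
    define qs where "qs = (p, \<lambda>x. inverse (w' p) * w' x)
      # map (\<lambda>(p0, k). (p0, \<lambda>x. k x - k p * inverse (w' p) * w' x)) ps"
    have E: "interpolate qs u x = interpolate ps u x + (u p - interpolate ps u p) * inverse (w' p) * w' x"
      for u x
    proof -
      have "(\<Sum>(p, k)\<leftarrow>map (\<lambda>(p0, k). (p0, \<lambda>x. k x - k p * inverse (w' p) * w' x)) ps. u p * k x)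
        = interpolate ps u x - interpolate ps u p * inverse (w' p) * w' x"
        unfolding interpolate_def by (induction ps) (auto simp: algebra_simps)
      then show ?thesis by (simp add: interpolate_def qs_def algebra_simps)
    qed
    have "interpolate qs v = v" if "v \<in> set (w # gs)" for v
    proof (cases "v \<in> set gs")
      case True
      then show ?thesis by (simp add: E ps(2) fun_eq_iff)
    next
      case False
      with that have v: "v = w" by simp
      have "w p - interpolate ps w p = w' p" by (simp add: w'_def)
      then have "interpolate qs w x = interpolate ps w x + w' x" for x
        using p by (simp add: E)
      then show ?thesis by (simp add: v w'_def fun_eq_iff)
    qed
    moreover have "snd ` set qs \<subseteq> V"
      using ps(1) w'V by (auto simp: qs_def intro!: subspace_dual_scaleD[OF V])
    ultimately show ?thesis by blast
  qed
qed

text \<open>A homogeneous linear system with more unknowns than equations has a nonzero solution.\<close>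

lemma ex_nontrivial_relation:
  fixes hs :: "('i \<Rightarrow> 'k::field) list"
  assumes "finite I" "length hs < card I"
  shows "\<exists>a. (\<exists>i\<in>I. a i \<noteq> 0) \<and> (\<forall>h\<in>set hs. (\<Sum>i\<in>I. a i * h i) = 0)"
  using assms
proof (induction "length hs" arbitrary: hs I)
  case 0
  then obtain i where "i \<in> I" by fastforce
  then show ?case using 0 by (intro exI[of _ "\<lambda>_. 1"]) auto
next
  case (Suc n)
  then obtain h gs where hs: "hs = h # gs" by (cases hs) auto
  show ?case
  proof (cases "\<exists>i\<in>I. h i \<noteq> 0")
    case False
    obtain a where "\<exists>i\<in>I. a i \<noteq> 0" "\<forall>h\<in>set gs. (\<Sum>i\<in>I. a i * h i) = 0"
      using Suc.hyps(1)[of gs I] Suc.hyps(2) Suc.prems hs by auto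
    then show ?thesis using False hs by (intro exI[of _ a]) auto
  next
    case True
    then obtain i where i: "i \<in> I" "h i \<noteq> 0" by blast
    let ?J = "I - {i}"
    define ks where "ks = map (\<lambda>g j. g j - g i / h i * h j) gs"
    have "n = length ks" "finite ?J" "length ks < card ?J"
      using Suc.hyps(2) Suc.prems hs i by (auto simp: ks_def card_Diff_singleton_if)
    from Suc.hyps(1)[OF this]
    obtain a where a1: "\<exists>j\<in>?J. a j \<noteq> 0" and ks: "\<forall>k\<in>set ks. (\<Sum>j\<in>?J. a j * k j) = 0"
      by (elim exE conjE)
    have a2: "(\<Sum>j\<in>?J. a j * (g j - g i / h i * h j)) = 0" if "g \<in> set gs" for g
      using ks that by (simp add: ks_def)
    define b where "b = a(i := - (\<Sum>j\<in>?J. a j * h j) / h i)"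
    have split: "(\<Sum>j\<in>I. b j * g j) = b i * g i + (\<Sum>j\<in>?J. a j * g j)" for g
      using Suc.prems(1) i(1) by (subst sum.remove[of I i]) (auto simp: b_def intro!: sum.cong)
    have "(\<Sum>j\<in>I. b j * g j) = 0" if "g \<in> set gs" for g
    proof -
      have "(\<Sum>j\<in>?J. a j * g j) - g i / h i * (\<Sum>j\<in>?J. a j * h j) = 0"
        using a2[OF that] by (simp add: algebra_simps sum_subtractf sum_distrib_left)
      then show ?thesis unfolding split by (simp add: b_def field_simps)
    qed
    moreover have "(\<Sum>j\<in>I. b j * h j) = 0"
      unfolding split using i(2) by (simp add: b_def)
    moreover have "\<exists>j\<in>I. b j \<noteq> 0"
      using a1 by (auto simp: b_def)
    ultimately show ?thesis by (intro exI[of _ b]) (auto simp: hs)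
  qed
qed


section \<open>Linearly recurrent sequences\<close>

text \<open>
  Two-sided sequences that satisfy one linear recurrence with constant coefficients at all integers.
  The last coefficient is allowed to vanish.
\<close>

definition linear_recurrent :: "(int \<Rightarrow> 'k::field) \<Rightarrow> bool" where
  "linear_recurrent F \<longleftrightarrow> (\<exists>(s::nat) c. \<forall>n::int. F n = (\<Sum>j=1..s. c j * F (n - int j)))"

text \<open>
  A two-sided sequence has finite Hankel rank if the matrix with entries \<open>F (i + j)\<close> has finite
  rank, which is expressed by an explicit decomposition into finitely many matrices of rank one.
\<close>

definition hankel_finite :: "(int \<Rightarrow> 'k::field) \<Rightarrow> bool" where
  "hankel_finite F \<longleftrightarrow> (\<exists>ps. \<forall>i j. F (i + j) = (\<Sum>(g, h)\<leftarrow>ps. g i * h j))"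

lemma hankel_finite_zero: "hankel_finite (\<lambda>_. 0)"
  unfolding hankel_finite_def by (rule exI[of _ "[]"]) simp

lemma hankel_finite_add:
  assumes "hankel_finite F" "hankel_finite G"
  shows "hankel_finite (\<lambda>n. F n + G n)"
proof -
  obtain ps qs where "\<And>i j. F (i + j) = (\<Sum>(g, h)\<leftarrow>ps. g i * h j)"
    "\<And>i j. G (i + j) = (\<Sum>(g, h)\<leftarrow>qs. g i * h j)"
    using assms unfolding hankel_finite_def by blast
  then show ?thesis unfolding hankel_finite_def by (intro exI[of _ "ps @ qs"]) simp
qed

lemma hankel_finite_scale:
  assumes "hankel_finite F"
  shows "hankel_finite (\<lambda>n. c * F n)"
proof -
  obtain ps where "\<And>i j. F (i + j) = (\<Sum>(g, h)\<leftarrow>ps. g i * h j)"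
    using assms unfolding hankel_finite_def by blast
  then show ?thesis unfolding hankel_finite_def
    by (intro exI[of _ "map (\<lambda>(g, h). (\<lambda>i. c * g i, h)) ps"])
      (simp add: comp_def split_def mult.assoc flip: sum_list_const_mult)
qed

lemma hankel_finite_shift:
  assumes "hankel_finite F"
  shows "hankel_finite (\<lambda>n. F (n + t))"
proof -
  obtain ps where ps: "\<And>i j. F (i + j) = (\<Sum>(g, h)\<leftarrow>ps. g i * h j)"
    using assms unfolding hankel_finite_def by blast
  have "F (i + j + t) = (\<Sum>(g, h)\<leftarrow>map (\<lambda>(g, h). (g, \<lambda>j. h (j + t))) ps. g i * h j)" for i j
    using ps[of i "j + t"] by (simp add: comp_def split_def add.assoc)
  then show ?thesis unfolding hankel_finite_def by blast
qed

lemma hankel_finite_of_int_mult: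
  assumes "hankel_finite F"
  shows "hankel_finite (\<lambda>n. of_int n * F n)"
proof -
  obtain ps where ps: "\<And>i j. F (i + j) = (\<Sum>(g, h)\<leftarrow>ps. g i * h j)"
    using assms unfolding hankel_finite_def by blast
  have "of_int (i + j) * F (i + j) = (\<Sum>(g, h)\<leftarrow>map (\<lambda>(g, h). (\<lambda>i. of_int i * g i, h)) ps
      @ map (\<lambda>(g, h). (g, \<lambda>j. of_int j * h j)) ps. g i * h j)" for i j
    unfolding ps by (induction ps) (auto simp: algebra_simps)
  then show ?thesis unfolding hankel_finite_def by blast
qed

lemma subspace_hankel_finite: "module.subspace dual_scale {F :: int \<Rightarrow> 'k::field. hankel_finite F}"
  by (simp add: subspace_dual_scale_iff hankel_finite_zero hankel_finite_add hankel_finite_scale)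

text \<open>If the last coefficient is nonzero, a recurrence can be run in both directions.\<close>

lemma recurrence_all_shifts:
  fixes F :: "int \<Rightarrow> 'k::field"
  assumes rec: "\<And>n. F n = (\<Sum>j=1..s. c j * F (n - int j))" and s: "s > 0" "c s \<noteq> 0"
    and V: "module.subspace dual_scale V"
    and base: "\<And>t. 0 \<le> t \<Longrightarrow> t < int s \<Longrightarrow> (\<lambda>n. F (n + t)) \<in> V"
  shows "(\<lambda>n. F (n + i)) \<in> V"
proof -
  note sub = module.subspace_sum[OF module_dual_scale V]
  have sumV: "(\<lambda>n. \<Sum>j\<in>J. b j * F (n + t j)) \<in> V"
    if "\<And>j. j \<in> J \<Longrightarrow> (\<lambda>n. F (n + t j)) \<in> V" for J :: "nat set" and t b
  proof -
    have "(\<Sum>j\<in>J. (\<lambda>n. b j * F (n + t j))) \<in> V"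
      by (rule sub) (use that subspace_dual_scaleD(3)[OF V] in blast)
    moreover have "(\<Sum>j\<in>J. (\<lambda>n. b j * F (n + t j))) = (\<lambda>n. \<Sum>j\<in>J. b j * F (n + t j))"
      by (induction J rule: infinite_finite_induct) (auto simp: fun_eq_iff)
    ultimately show ?thesis by simp
  qed
  have "\<forall>t. i \<le> t \<and> t < i + int s \<longrightarrow> (\<lambda>n. F (n + t)) \<in> V" for i
  proof (induction i rule: int_induct[of _ 0])
    case base
    then show ?case using assms(5) by auto
  next
    case (step1 i)
    have "(\<lambda>n. \<Sum>j=1..s. c j * F (n + (i + int s - int j))) \<in> V"
      by (rule sumV) (use step1.IH s in auto)
    moreover have "(\<lambda>n. \<Sum>j=1..s. c j * F (n + (i + int s - int j))) = (\<lambda>n. F (n + (i + int s)))"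
      by (subst (2) rec) (simp add: algebra_simps)
    ultimately have new: "(\<lambda>n. F (n + (i + int s))) \<in> V" by simp
    show ?case
    proof (intro allI impI)
      fix t assume "i + 1 \<le> t \<and> t < i + 1 + int s"
      then show "(\<lambda>n. F (n + t)) \<in> V"
        using step1.IH new by (cases "t = i + int s") auto
    qed
  next
    case (step2 i)
    have "(\<lambda>n. \<Sum>j\<in>{1..<s}. c j * F (n + (i - 1 + int s - int j))) \<in> V"
      by (rule sumV) (use step2.IH in auto)
    moreover have "(\<lambda>n. F (n + (i - 1 + int s))) \<in> V"
      using step2.IH s by auto
    ultimately have "(\<lambda>n. inverse (c s) * (F (n + (i - 1 + int s))
        - (\<Sum>j\<in>{1..<s}. c j * F (n + (i - 1 + int s - int j))))) \<in> V"
      using subspace_dual_scaleD(3,4)[OF V] by blast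
    moreover have "inverse (c s) * (F (n + (i - 1 + int s))
        - (\<Sum>j\<in>{1..<s}. c j * F (n + (i - 1 + int s - int j)))) = F (n + (i - 1))" for n
    proof -
      have "{1..s} = insert s {1..<s}" using s(1) by auto
      then have "F (n + (i - 1 + int s)) = c s * F (n + (i - 1))
          + (\<Sum>j\<in>{1..<s}. c j * F (n + (i - 1 + int s - int j)))"
        by (subst rec) (simp add: algebra_simps)
      then show ?thesis using s(2) by simp
    qed
    ultimately have new: "(\<lambda>n. F (n + (i - 1))) \<in> V" by simp
    show ?case
    proof (intro allI impI)
      fix t assume "i - 1 \<le> t \<and> t < i - 1 + int s"
      then show "(\<lambda>n. F (n + t)) \<in> V"
        using step2.IH new by (cases "t = i - 1") auto
    qed
  qed
  from this[of i] show ?thesis using s(1) by auto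
qed

text \<open>
  The shifts of a recurrent sequence span a finite-dimensional space, and interpolation there
  splits \<open>F (i + j)\<close> into shifts of \<open>F\<close> in the first variable and functions of that space in
  the second.
\<close>

lemma linear_recurrent_interpolation:
  fixes F :: "int \<Rightarrow> 'k::field"
  assumes F: "linear_recurrent F" and V: "module.subspace dual_scale V"
    and shifts: "\<And>t. (\<lambda>n. F (n + t)) \<in> V"
  shows "\<exists>ps. snd ` set ps \<subseteq> V \<and> (\<forall>i j. F (i + j) = (\<Sum>(p, k)\<leftarrow>ps. F (i + p) * k j))"
proof -
  obtain s c where "\<And>n. F n = (\<Sum>j=1..s. c j * F (n - int j))"
    using F unfolding linear_recurrent_def by blast
  then show ?thesis
  proof (induction s)
    case 0
    have "F n = 0" for n using 0[of n] by simp
    then show ?case by (intro exI[of _ "[]"]) simp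
  next
    case (Suc s)
    show ?case
    proof (cases "c (Suc s) = 0")
      case True
      have "F n = (\<Sum>j=1..s. c j * F (n - int j))" for n
        using Suc.prems[of n] True by simp
      then show ?thesis by (rule Suc.IH)
    next
      case False
      define gs where "gs = map (\<lambda>t. (\<lambda>n. F (n + int t))) [0..<Suc s]"
      have "set gs \<subseteq> V" using shifts by (auto simp: gs_def)
      from ex_interpolation[OF V this]
      obtain ps where ps: "snd ` set ps \<subseteq> V" "\<forall>v\<in>set gs. interpolate ps v = v"
        by blast
      have "(\<lambda>n. F (n + i)) \<in> {v. interpolate ps v = v}" for i
      proof (rule recurrence_all_shifts[OF Suc.prems])
        show "module.subspace dual_scale {v. interpolate ps v = v}"
          unfolding subspace_dual_scale_iff
          by (auto simp: interpolate_add interpolate_scale) (simp add: interpolate_def split_def)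
        show "(\<lambda>n. F (n + t)) \<in> {v. interpolate ps v = v}" if "0 \<le> t" "t < int (Suc s)" for t
        proof -
          have "(\<lambda>n. F (n + int (nat t))) \<in> set gs"
            unfolding gs_def set_map by (rule imageI) (use that in auto)
          then show ?thesis using bspec[OF ps(2)] that(1) by simp
        qed
      qed (use False in auto)
      then have shift: "interpolate ps (\<lambda>n. F (n + i)) j = F (j + i)" for i j
        by simp
      have "F (i + j) = (\<Sum>(p, k)\<leftarrow>ps. F (i + p) * k j)" for i j
        using shift[of i j, symmetric] by (simp add: interpolate_def add.commute)
      then show ?thesis using ps(1) by blast
    qed
  qed
qed

lemma linear_recurrent_iff_hankel_finite: "linear_recurrent F \<longleftrightarrow> hankel_finite F"
proof
  assume F: "linear_recurrent F"
  have UNIV: "module.subspace dual_scale (UNIV :: (int \<Rightarrow> 'a) set)"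
    by (simp add: subspace_dual_scale_iff)
  from linear_recurrent_interpolation[OF F UNIV]
  obtain ps where ps: "\<And>i j. F (i + j) = (\<Sum>(p, k)\<leftarrow>ps. F (i + p) * k j)"
    by blast
  show "hankel_finite F"
    unfolding hankel_finite_def
  proof (intro exI allI)
    show "F (i + j) = (\<Sum>(g, h)\<leftarrow>map (\<lambda>(p, k). (\<lambda>i. F (i + p), k)) ps. g i * h j)" for i j
      by (subst ps) (simp add: comp_def split_def)
  qed
next
  assume "hankel_finite F"
  then obtain ps where ps: "\<And>i j. F (i + j) = (\<Sum>(g, h)\<leftarrow>ps. g i * h j)"
    unfolding hankel_finite_def by blast
  define s where "s = length ps"
  obtain a where a: "\<exists>i\<in>{0..s}. a i \<noteq> 0"
    "\<And>g h. (g, h) \<in> set ps \<Longrightarrow> (\<Sum>i\<in>{0..s}. a i * g (int i)) = 0"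
    using ex_nontrivial_relation[of "{0..s}" "map (\<lambda>(g, h) i. g (int i)) ps"]
    by (fastforce simp: s_def)
  have rel: "(\<Sum>i\<in>{0..s}. a i * F (int i + j)) = 0" for j
  proof -
    have "(\<Sum>i\<in>{0..s}. a i * F (int i + j)) = (\<Sum>(g, h)\<leftarrow>ps. (\<Sum>i\<in>{0..s}. a i * g (int i)) * h j)"
      unfolding ps by (induction ps)
        (auto simp: sum.distrib algebra_simps sum_distrib_left sum_distrib_right)
    also have "\<dots> = (\<Sum>_\<leftarrow>ps. 0)"
      by (rule arg_cong[of _ _ sum_list], rule map_cong) (auto simp: a(2))
    finally show ?thesis by simp
  qed
  define d where "d = Max {i\<in>{0..s}. a i \<noteq> 0}"
  have "d \<in> {i\<in>{0..s}. a i \<noteq> 0}"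
    unfolding d_def by (rule Max_in) (use a(1) in auto)
  then have d: "d \<le> s" "a d \<noteq> 0" by auto
  have above: "a i = 0" if "d < i" "i \<le> s" for i
    using that Max_ge[of "{i\<in>{0..s}. a i \<noteq> 0}" i] by (fastforce simp: d_def)
  have "F n = (\<Sum>l=1..d. (- a (d - l) / a d) * F (n - int l))" for n
  proof -
    have "0 = (\<Sum>i\<in>{0..d}. a i * F (int i + (n - int d)))"
      unfolding rel[of "n - int d", symmetric]
      by (rule sum.mono_neutral_right) (use d above in auto)
    also have "\<dots> = a d * F n + (\<Sum>i\<in>{0..<d}. a i * F (int i + (n - int d)))"
    proof -
      have "{0..d} = insert d {0..<d}" by auto
      then show ?thesis by simp
    qed
    also have "(\<Sum>i\<in>{0..<d}. a i * F (int i + (n - int d))) = (\<Sum>l=1..d. a (d - l) * F (n - int l))"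
      by (rule sum.reindex_bij_witness[of _ "\<lambda>l. d - l" "\<lambda>i. d - i"])
        (auto simp: of_nat_diff algebra_simps)
    finally have *: "a d * F n = - (\<Sum>l=1..d. a (d - l) * F (n - int l))"
      by (simp add: eq_neg_iff_add_eq_0)
    have "F n = inverse (a d) * (a d * F n)" using d(2) by simp
    also have "\<dots> = (\<Sum>l=1..d. (- a (d - l) / a d) * F (n - int l))"
      unfolding * by (simp add: sum_distrib_left sum_negf divide_inverse algebra_simps)
    finally show ?thesis .
  qed
  then show "linear_recurrent F" unfolding linear_recurrent_def
    by (intro exI[of _ d] exI[of _ "\<lambda>l. - a (d - l) / a d"] allI)
qed

text \<open>The factors of a decomposition may be taken of finite Hankel rank as well.\<close>

lemma hankel_finite_split:
  fixes F :: "int \<Rightarrow> 'k::field"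
  assumes "hankel_finite F"
  shows "\<exists>ps. (\<forall>(g, h)\<in>set ps. hankel_finite g \<and> hankel_finite h) \<and>
    (\<forall>i j. F (i + j) = (\<Sum>(g, h)\<leftarrow>ps. g i * h j))"
proof -
  have "linear_recurrent F" using assms by (simp add: linear_recurrent_iff_hankel_finite)
  moreover have "(\<lambda>n. F (n + t)) \<in> {F. hankel_finite F}" for t
    using hankel_finite_shift[OF assms] by simp
  ultimately obtain ps where ps: "snd ` set ps \<subseteq> {F. hankel_finite F}"
    "\<And>i j. F (i + j) = (\<Sum>(p, k)\<leftarrow>ps. F (i + p) * k j)"
    using linear_recurrent_interpolation[OF _ subspace_hankel_finite] by blast
  show ?thesis
  proof (intro exI conjI allI)
    show "\<forall>(g, h)\<in>set (map (\<lambda>(p, k). (\<lambda>i. F (i + p), k)) ps). hankel_finite g \<and> hankel_finite h"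
      using ps(1) by (auto simp: hankel_finite_shift[OF assms])
    show "F (i + j) = (\<Sum>(g, h)\<leftarrow>map (\<lambda>(p, k). (\<lambda>i. F (i + p), k)) ps. g i * h j)" for i j
      by (subst ps(2)) (simp add: comp_def split_def)
  qed
qed

section \<open>Multilinear forms and tensors\<close>

lemma linear_formD:
  assumes "linear_form s V f"
  shows "x \<in> V \<Longrightarrow> y \<in> V \<Longrightarrow> f (x + y) = f x + f y" "x \<in> V \<Longrightarrow> f (s c x) = c * f x"
  using assms by (auto simp: linear_form_def)

lemma linear_form_zero:
  assumes "vector_space s" "module.subspace s V" "linear_form s V f"
  shows "f 0 = 0"
proof -
  interpret vector_space s by fact
  have "f (s 0 0) = 0 * f 0" by (rule linear_formD(2)[OF assms(3)]) (rule subspace_0[OF assms(2)])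
  then show ?thesis by simp
qed

lemma linear_form_minus:
  assumes "vector_space s" "module.subspace s V" "linear_form s V f" "x \<in> V"
  shows "f (- x) = - f x"
proof -
  interpret vector_space s by fact
  have "f (s (- 1) x) = - 1 * f x" by (rule linear_formD(2)[OF assms(3,4)])
  then show ?thesis by simp
qed

lemma bilinear_formD:
  assumes "bilinear_form s V B" "z \<in> V"
  shows "linear_form s V (\<lambda>x. B x z)" "linear_form s V (\<lambda>x. B z x)"
  using assms by (auto simp: bilinear_form_def)

lemma trilinear_formD:
  assumes "trilinear_form s V T" "y \<in> V" "z \<in> V"
  shows "linear_form s V (\<lambda>x. T x y z)" "linear_form s V (\<lambda>x. T y x z)" "linear_form s V (\<lambda>x. T y z x)"
  using assms by (auto simp: trilinear_form_def)

lemma linear_form_add: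
  "linear_form s V f \<Longrightarrow> linear_form s V g \<Longrightarrow> linear_form s V (\<lambda>x. f x + g x)"
  by (auto simp: linear_form_def algebra_simps)

lemma linear_form_mult:
  "linear_form s V f \<Longrightarrow> linear_form s V (\<lambda>x. c * f x)"
  "linear_form s V f \<Longrightarrow> linear_form s V (\<lambda>x. f x * c)"
  by (auto simp: linear_form_def algebra_simps)

lemma linear_form_sum_list:
  "(\<And>a. a \<in> set as \<Longrightarrow> linear_form s V (F a)) \<Longrightarrow> linear_form s V (\<lambda>x. \<Sum>a\<leftarrow>as. F a x)"
  by (induction as) (auto intro: linear_form_add simp: linear_form_def[of _ _ "\<lambda>_. 0"])

lemma bilinear_form_mult:
  "linear_form s V f \<Longrightarrow> linear_form s V g \<Longrightarrow> bilinear_form s V (\<lambda>x y. f x * g y)"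
  by (simp add: bilinear_form_def linear_form_mult)

lemma bilinear_form_add:
  "bilinear_form s V B \<Longrightarrow> bilinear_form s V C \<Longrightarrow> bilinear_form s V (\<lambda>x y. B x y + C x y)"
  by (simp add: bilinear_form_def linear_form_add)

lemma bilinear_form_flip: "bilinear_form s V B \<Longrightarrow> bilinear_form s V (\<lambda>x y. B y x)"
  by (simp add: bilinear_form_def)

lemma trilinear_form_section:
  assumes "trilinear_form s V T" "x \<in> V"
  shows "bilinear_form s V (T x)" "bilinear_form s V (\<lambda>y z. T y z x)" "bilinear_form s V (\<lambda>y z. T z x y)"
  using assms by (auto simp: trilinear_form_def bilinear_form_def)

lemma bilinear_form_evals: "bilinear_form dual_scale V (\<lambda>g h. g \<xi> * h \<eta>)"
  by (rule bilinear_form_mult) (auto simp: linear_form_def dual_scale_def)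

lemma tensor_of_bilinear: "bilinear_form s V B \<Longrightarrow> tensor_of s V r B = (\<Sum>(x, y)\<leftarrow>r. B x y)"
  by (simp add: tensor_of_def)

lemma tensor_square_not_bilinear: "t \<in> tensor_square s V \<Longrightarrow> \<not> bilinear_form s V B \<Longrightarrow> t B = 0"
  by (auto simp: tensor_square_def tensor_of_def)

lemma tensor_square_add:
  assumes "t \<in> tensor_square s V" "t' \<in> tensor_square s V"
  shows "t + t' \<in> tensor_square s V"
proof -
  obtain r r' where r: "t = tensor_of s V r" "set r \<subseteq> V \<times> V" "t' = tensor_of s V r'" "set r' \<subseteq> V \<times> V"
    using assms by (auto simp: tensor_square_def)
  have "t + t' = tensor_of s V (r @ r')"
    by (auto simp: r fun_eq_iff tensor_of_def)
  then show ?thesis using r by (auto simp: tensor_square_def intro!: exI[of _ "r @ r'"])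
qed

lemma tensor_square_scale:
  assumes "vector_space s" "module.subspace s V" "t \<in> tensor_square s V"
  shows "(\<lambda>B. c * t B) \<in> tensor_square s V"
proof -
  interpret vector_space s by fact
  obtain r where r: "t = tensor_of s V r" "set r \<subseteq> V \<times> V"
    using assms by (auto simp: tensor_square_def)
  let ?r = "map (\<lambda>(x, y). (s c x, y)) r"
  have "c * (\<Sum>(x, y)\<leftarrow>r. B x y) = (\<Sum>(x, y)\<leftarrow>?r. B x y)" if B: "bilinear_form s V B" for B
    using r(2) by (induction r)
      (auto simp: algebra_simps linear_formD(2)[OF bilinear_formD(1)[OF B]])
  then have "(\<lambda>B. c * t B) = tensor_of s V ?r"
    by (simp add: r fun_eq_iff tensor_of_def)
  moreover have "set ?r \<subseteq> V \<times> V" using r(2) subspace_scale[OF assms(2)] by auto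
  ultimately show ?thesis unfolding tensor_square_def by blast
qed

lemma tensor_square_diff:
  assumes "vector_space s" "module.subspace s V" "t \<in> tensor_square s V" "t' \<in> tensor_square s V"
  shows "t - t' \<in> tensor_square s V"
  using tensor_square_add[OF assms(3) tensor_square_scale[OF assms(1,2,4), of "- 1"]]
  by (simp add: plus_fun_def fun_diff_def)

lemma sum_list_swap:
  fixes f :: "'a \<Rightarrow> 'b \<Rightarrow> 'c::comm_monoid_add"
  shows "(\<Sum>x\<leftarrow>xs. \<Sum>y\<leftarrow>ys. f x y) = (\<Sum>y\<leftarrow>ys. \<Sum>x\<leftarrow>xs. f x y)"
  by (induction xs) (simp_all add: sum_list_addf)

lemma sum_list_minus: "(\<Sum>x\<leftarrow>xs. - f x) = - (\<Sum>x\<leftarrow>xs. f x :: 'k::ab_group_add)"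
  by (induction xs) auto

lemma sum_list_cong: "(\<And>x. x \<in> set xs \<Longrightarrow> f x = g x) \<Longrightarrow> (\<Sum>x\<leftarrow>xs. f x) = (\<Sum>x\<leftarrow>xs. g x)"
  by (rule arg_cong[of _ _ sum_list]) simp

lemma sum_list_concat_map: "(\<Sum>x\<leftarrow>concat xss. f x) = (\<Sum>xs\<leftarrow>xss. \<Sum>x\<leftarrow>xs. f x)"
  by (induction xss) auto

lemma linear_form_of_sum_list:
  fixes V :: "('v \<Rightarrow> 'k::field) set"
  assumes V: "module.subspace dual_scale V" and f: "linear_form dual_scale V f"
    and "\<And>a. a \<in> set as \<Longrightarrow> F a \<in> V"
  shows "f (\<lambda>x. \<Sum>a\<leftarrow>as. c a * F a x) = (\<Sum>a\<leftarrow>as. c a * f (F a))"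
  using assms(3)
proof (induction as)
  case Nil
  then show ?case
    using linear_form_zero[OF vector_space_dual_scale V f] by (simp add: zero_fun_def)
next
  case (Cons a as)
  have mem: "dual_scale (c a) (F a) \<in> V" "(\<lambda>x. \<Sum>a\<leftarrow>as. c a * F a x) \<in> V"
    unfolding dual_scale_def
    using Cons.prems by (auto intro!: subspace_sum_list[OF V] subspace_dual_scaleD(3)[OF V])
  have "(\<lambda>x. \<Sum>a\<leftarrow>a # as. c a * F a x) = dual_scale (c a) (F a) + (\<lambda>x. \<Sum>a\<leftarrow>as. c a * F a x)"
    by (auto simp: fun_eq_iff dual_scale_def)
  then show ?case
    using Cons linear_formD(1)[OF f mem] linear_formD(2)[OF f, of "F a" "c a"] by simp
qed

lemma linear_form_interpolate:
  fixes V :: "('v \<Rightarrow> 'k::field) set"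
  assumes "module.subspace dual_scale V" "linear_form dual_scale V f" "snd ` set ps \<subseteq> V"
    "interpolate ps u = u"
  shows "f u = (\<Sum>(p, k)\<leftarrow>ps. u p * f k)"
proof -
  have "f (interpolate ps u) = (\<Sum>(p, k)\<leftarrow>ps. u p * f k)"
    unfolding interpolate_def split_def
    by (rule linear_form_of_sum_list[OF assms(1,2)]) (use assms(3) in auto)
  then show ?thesis by (simp add: assms(4))
qed

text \<open>
  Interpolation in the first factor expresses a tensor of functions through its values at
  points, which therefore determine it.
\<close>

lemma tensor_interpolate:
  fixes V :: "('v \<Rightarrow> 'k::field) set"
  assumes V: "module.subspace dual_scale V" and B: "bilinear_form dual_scale V B"
    and r: "set r \<subseteq> V \<times> V" and ps: "snd ` set ps \<subseteq> V" "\<And>g. g \<in> fst ` set r \<Longrightarrow> interpolate ps g = g"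
  shows "tensor_of dual_scale V r B = (\<Sum>(p, k)\<leftarrow>ps. B k (eval_tensor (tensor_of dual_scale V r) p))"
proof -
  have ev: "eval_tensor (tensor_of dual_scale V r) p = (\<lambda>\<eta>. \<Sum>(g, h)\<leftarrow>r. g p * h \<eta>)" for p
    by (rule ext) (simp add: eval_tensor_def tensor_of_bilinear[OF bilinear_form_evals])
  have "tensor_of dual_scale V r B = (\<Sum>gh\<leftarrow>r. \<Sum>pk\<leftarrow>ps. fst gh (fst pk) * B (snd pk) (snd gh))"
    unfolding tensor_of_bilinear[OF B] split_def
  proof (rule sum_list_cong)
    fix gh assume gh: "gh \<in> set r"
    show "B (fst gh) (snd gh) = (\<Sum>pk\<leftarrow>ps. fst gh (fst pk) * B (snd pk) (snd gh))"
      using linear_form_interpolate[OF V bilinear_formD(1)[OF B] ps(1) ps(2), of "snd gh" "fst gh"] gh r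
      by (auto simp: split_def)
  qed
  also have "\<dots> = (\<Sum>pk\<leftarrow>ps. \<Sum>gh\<leftarrow>r. fst gh (fst pk) * B (snd pk) (snd gh))"
    by (rule sum_list_swap)
  also have "\<dots> = (\<Sum>(p, k)\<leftarrow>ps. B k (eval_tensor (tensor_of dual_scale V r) p))"
    unfolding ev split_def
  proof (rule sum_list_cong)
    fix pk assume pk: "pk \<in> set ps"
    then have "snd pk \<in> V" using ps(1) by auto
    from bilinear_formD(2)[OF B this]
    show "(\<Sum>gh\<leftarrow>r. fst gh (fst pk) * B (snd pk) (snd gh))
      = B (snd pk) (\<lambda>\<eta>. \<Sum>gh\<leftarrow>r. fst gh (fst pk) * snd gh \<eta>)"
      by (rule linear_form_of_sum_list[OF V, symmetric]) (use r in auto)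
  qed
  finally show ?thesis .
qed

lemma tensor_square_eqI:
  fixes V :: "('v \<Rightarrow> 'k::field) set"
  assumes V: "module.subspace dual_scale V"
    and "t \<in> tensor_square dual_scale V" "t' \<in> tensor_square dual_scale V"
    and eq: "eval_tensor t = eval_tensor t'"
  shows "t = t'"
proof
  fix B
  obtain r r' where r: "t = tensor_of dual_scale V r" "set r \<subseteq> V \<times> V"
    and r': "t' = tensor_of dual_scale V r'" "set r' \<subseteq> V \<times> V"
    using assms(2,3) by (auto simp: tensor_square_def)
  have "set (map fst (r @ r')) \<subseteq> V" using r(2) r'(2) by auto
  from ex_interpolation[OF V this] obtain ps where ps: "snd ` set ps \<subseteq> V"
    "\<forall>v\<in>set (map fst (r @ r')). interpolate ps v = v" by blast
  show "t B = t' B"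
  proof (cases "bilinear_form dual_scale V B")
    case True
    have "t B = (\<Sum>(p, k)\<leftarrow>ps. B k (eval_tensor t p))"
      unfolding r(1) by (rule tensor_interpolate[OF V True r(2) ps(1)]) (use ps(2) in auto)
    moreover have "t' B = (\<Sum>(p, k)\<leftarrow>ps. B k (eval_tensor t' p))"
      unfolding r'(1) by (rule tensor_interpolate[OF V True r'(2) ps(1)]) (use ps(2) in auto)
    ultimately show ?thesis by (simp add: eq)
  next
    case False
    then show ?thesis using assms(2,3) by (simp add: tensor_square_not_bilinear)
  qed
qed

text \<open>On a finite-dimensional space, a trilinear form is a combination of triple evaluations.\<close>

lemma trilinear_interpolate:
  fixes V :: "('v \<Rightarrow> 'k::field) set"
  assumes V: "module.subspace dual_scale V" and T: "trilinear_form dual_scale V T"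
    and ps: "snd ` set ps \<subseteq> V"
  shows "\<exists>qs. \<forall>u\<in>V. \<forall>v\<in>V. \<forall>w\<in>V. interpolate ps u = u \<longrightarrow> interpolate ps v = v \<longrightarrow> interpolate ps w = w \<longrightarrow>
    T u v w = (\<Sum>(c, x, y, z)\<leftarrow>qs. c * (u x * v y * w z))"
proof -
  define qs where "qs = concat (map (\<lambda>(x, k). concat (map (\<lambda>(y, l). map (\<lambda>(z, m). (T k l m, x, y, z)) ps) ps)) ps)"
  have qs: "(\<Sum>(c, x, y, z)\<leftarrow>qs. c * (u x * v y * w z))
     = (\<Sum>(x, k)\<leftarrow>ps. \<Sum>(y, l)\<leftarrow>ps. \<Sum>(z, m)\<leftarrow>ps. T k l m * (u x * v y * w z))" for u v w
    unfolding qs_def by (simp add: sum_list_concat_map comp_def split_def)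
  have "T u v w = (\<Sum>(c, x, y, z)\<leftarrow>qs. c * (u x * v y * w z))"
    if uvw: "u \<in> V" "v \<in> V" "w \<in> V"
      and fx: "interpolate ps u = u" "interpolate ps v = v" "interpolate ps w = w" for u v w
  proof -
    have "T u v w = (\<Sum>(x, k)\<leftarrow>ps. u x * T k v w)"
      by (rule linear_form_interpolate[OF V trilinear_formD(1)[OF T] ps fx(1)]) fact+
    also have "\<dots> = (\<Sum>(x, k)\<leftarrow>ps. \<Sum>(y, l)\<leftarrow>ps. \<Sum>(z, m)\<leftarrow>ps. T k l m * (u x * v y * w z))"
    proof (rule sum_list_cong, clarify)
      fix x k assume "(x, k) \<in> set ps"
      then have k: "k \<in> V" using ps by auto
      have "T k v w = (\<Sum>(y, l)\<leftarrow>ps. v y * T k l w)"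
        by (rule linear_form_interpolate[OF V trilinear_formD(2)[OF T] ps fx(2)]) fact+
      also have "\<dots> = (\<Sum>(y, l)\<leftarrow>ps. \<Sum>(z, m)\<leftarrow>ps. T k l m * (v y * w z))"
      proof (rule sum_list_cong, clarify)
        fix y l assume "(y, l) \<in> set ps"
        then have l: "l \<in> V" using ps by auto
        have "T k l w = (\<Sum>(z, m)\<leftarrow>ps. w z * T k l m)"
          by (rule linear_form_interpolate[OF V trilinear_formD(3)[OF T] ps fx(3)]) fact+
        then show "v y * T k l w = (\<Sum>(z, m)\<leftarrow>ps. T k l m * (v y * w z))"
          by (simp add: split_def mult_ac flip: sum_list_const_mult)
      qed
      finally show "u x * T k v w = (\<Sum>(y, l)\<leftarrow>ps. \<Sum>(z, m)\<leftarrow>ps. T k l m * (u x * v y * w z))"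
        by (simp add: split_def mult_ac flip: sum_list_const_mult)
    qed
    finally show ?thesis unfolding qs .
  qed
  then show ?thesis by blast
qed


section \<open>The dual of a Lie bialgebra\<close>

text \<open>
  Let \<open>V\<close> be a space of functionals on a Lie bialgebra \<open>(L, [\<cdot>,\<cdot>], \<delta>)\<close> that is closed under the dual of
  \<open>\<delta>\<close> and such that the functional \<open>f [\<xi>, \<eta>]\<close> on pairs comes from a tensor \<open>\<Delta> f\<close> in \<open>V \<otimes> V\<close>, for every
  \<open>f\<close> in \<open>V\<close>.  Then \<open>V\<close> is a Lie bialgebra.  Each of its axioms is the transpose of an axiom of \<open>L\<close>.
  The axioms of the bracket are pointwise on \<open>L\<close>; those of \<open>\<Delta>\<close> are identities between
  tensors over \<open>V\<close>, for which it is enough to compare values at points of \<open>L\<close>.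
\<close>

lemma lie_algebraD:
  assumes "lie_algebra s V br"
  shows "vector_space s" "module.subspace s V"
    "x \<in> V \<Longrightarrow> y \<in> V \<Longrightarrow> br x y \<in> V"
    "x \<in> V \<Longrightarrow> y \<in> V \<Longrightarrow> z \<in> V \<Longrightarrow> br (x + y) z = br x z + br y z"
    "x \<in> V \<Longrightarrow> y \<in> V \<Longrightarrow> z \<in> V \<Longrightarrow> br z (x + y) = br z x + br z y"
    "x \<in> V \<Longrightarrow> y \<in> V \<Longrightarrow> br (s c x) y = s c (br x y)"
    "x \<in> V \<Longrightarrow> y \<in> V \<Longrightarrow> br x (s c y) = s c (br x y)"
    "x \<in> V \<Longrightarrow> br x x = 0"
    "x \<in> V \<Longrightarrow> y \<in> V \<Longrightarrow> z \<in> V \<Longrightarrow> br x (br y z) + br y (br z x) + br z (br x y) = 0"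
  using assms by (auto simp: lie_algebra_def)

lemma lie_algebra_skew:
  assumes L: "lie_algebra s V br" and "x \<in> V" "y \<in> V"
  shows "br x y = - br y x"
proof -
  interpret vector_space s by (rule lie_algebraD(1)[OF L])
  have xy: "x + y \<in> V" by (rule subspace_add[OF lie_algebraD(2)[OF L]]) fact+
  have "0 = br (x + y) (x + y)" using lie_algebraD(8)[OF L xy] by simp
  also have "\<dots> = br x (x + y) + br y (x + y)" by (rule lie_algebraD(4)[OF L]) fact+
  also have "\<dots> = br x y + br y x"
    using assms(2,3) by (simp add: lie_algebraD(5)[OF L] lie_algebraD(8)[OF L])
  finally show ?thesis by (simp add: eq_neg_iff_add_eq_0)
qed

lemma bilinear_form_act:
  assumes L: "lie_algebra s V br" and z: "z \<in> V" and B: "bilinear_form s V B"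
  shows "bilinear_form s V (\<lambda>x y. B (br z x) y + B x (br z y))"
  unfolding bilinear_form_def linear_form_def
  using z by (simp add: lie_algebraD(3,5,7)[OF L] linear_formD[OF bilinear_formD(1)[OF B]]
    linear_formD[OF bilinear_formD(2)[OF B]] module.subspace_add[OF _ lie_algebraD(2)[OF L]]
    module.subspace_scale[OF _ lie_algebraD(2)[OF L]] module_iff_vector_space lie_algebraD(1)[OF L]
    algebra_simps)

lemma tensor_act_tensor_of:
  assumes L: "lie_algebra s V br" and z: "z \<in> V" and B: "bilinear_form s V B"
  shows "tensor_act s V br z (tensor_of s V r) B = (\<Sum>(x, y)\<leftarrow>r. B (br z x) y + B x (br z y))"
  by (simp add: tensor_act_def B tensor_of_bilinear[OF bilinear_form_act[OF L z B]])

lemma tensor_act_in_tensor_square: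
  assumes L: "lie_algebra s V br" and z: "z \<in> V" and t: "t \<in> tensor_square s V"
  shows "tensor_act s V br z t \<in> tensor_square s V"
proof -
  obtain r where r: "t = tensor_of s V r" "set r \<subseteq> V \<times> V"
    using t by (auto simp: tensor_square_def)
  let ?r = "concat (map (\<lambda>(x, y). [(br z x, y), (x, br z y)]) r)"
  have "(\<Sum>(x, y)\<leftarrow>r. B (br z x) y + B x (br z y)) = (\<Sum>(x, y)\<leftarrow>?r. B x y)" for B :: "_ \<Rightarrow> _ \<Rightarrow> 'a"
    by (induction r) (auto simp: algebra_simps)
  then have "tensor_act s V br z t = tensor_of s V ?r"
    using tensor_act_tensor_of[OF L z] unfolding r
    by (auto simp: fun_eq_iff tensor_of_def tensor_act_def)
  moreover have "set ?r \<subseteq> V \<times> V" using r(2) z lie_algebraD(3)[OF L] by auto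
  ultimately show ?thesis unfolding tensor_square_def by blast
qed

lemma lie_coalgebraD:
  assumes "lie_coalgebra s V \<delta>"
  shows "vector_space s" "module.subspace s V" "x \<in> V \<Longrightarrow> \<delta> x \<in> tensor_square s V"
    "bilinear_form s V B \<Longrightarrow> linear_form s V (\<lambda>x. \<delta> x B)"
    "x \<in> V \<Longrightarrow> bilinear_form s V B \<Longrightarrow> \<delta> x (\<lambda>u v. B v u) = - \<delta> x B"
    "x \<in> V \<Longrightarrow> trilinear_form s V T \<Longrightarrow>
        \<delta> x (\<lambda>u v. \<delta> v (\<lambda>w z. T u w z + T w z u + T z u w)) = 0"
  using assms unfolding lie_coalgebra_def by blast+

lemma tensor_square_bilinear_add:
  assumes "t \<in> tensor_square s V" "bilinear_form s V B" "bilinear_form s V C"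
  shows "t (\<lambda>x y. B x y + C x y) = t B + t C"
proof -
  obtain r where r: "t = tensor_of s V r" using assms(1) by (auto simp: tensor_square_def)
  show ?thesis unfolding r
    by (simp add: tensor_of_bilinear assms(2,3) bilinear_form_add split_def sum_list_addf)
qed

lemma bilinear_form_scale: "bilinear_form s V B \<Longrightarrow> bilinear_form s V (\<lambda>x y. c * B x y)"
  by (simp add: bilinear_form_def linear_form_mult)

lemma tensor_square_bilinear_scale:
  assumes "t \<in> tensor_square s V" "bilinear_form s V B"
  shows "t (\<lambda>x y. c * B x y) = c * t B"
proof -
  obtain r where r: "t = tensor_of s V r" using assms(1) by (auto simp: tensor_square_def)
  show ?thesis unfolding r
    by (simp add: tensor_of_bilinear assms(2) bilinear_form_scale split_def sum_list_const_mult)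
qed

text \<open>
  The Jacobi identity of the dual bracket is the co-Jacobi identity of \<open>\<delta>\<close> on the trilinear form
  \<open>f u * g v * h w\<close>.
\<close>

lemma lie_algebra_dual:
  fixes V :: "('v::ab_group_add \<Rightarrow> 'k::field) set"
  assumes co: "lie_coalgebra s UNIV \<delta>" and two: "(2 :: 'k) \<noteq> 0"
    and V: "module.subspace dual_scale V" and lin: "\<And>f. f \<in> V \<Longrightarrow> linear_form s UNIV f"
    and closed: "\<And>f h. f \<in> V \<Longrightarrow> h \<in> V \<Longrightarrow> cobracket_dual \<delta> f h \<in> V"
  shows "lie_algebra dual_scale V (cobracket_dual \<delta>)"
proof -
  let ?b = "cobracket_dual \<delta>"
  note d = lie_coalgebraD(3)[OF co UNIV_I]
  have bil: "bilinear_form s UNIV (\<lambda>x y. f x * g y)" if "f \<in> V" "g \<in> V" for f g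
    by (rule bilinear_form_mult) (use that lin in auto)
  have addl: "?b (f + g) h = ?b f h + ?b g h" if "f \<in> V" "g \<in> V" "h \<in> V" for f g h
    using tensor_square_bilinear_add[OF d bil[OF that(1,3)] bil[OF that(2,3)]]
    by (simp add: cobracket_dual_def pair_tensor_def fun_eq_iff algebra_simps)
  have addr: "?b h (f + g) = ?b h f + ?b h g" if "f \<in> V" "g \<in> V" "h \<in> V" for f g h
    using tensor_square_bilinear_add[OF d bil[OF that(3,1)] bil[OF that(3,2)]]
    by (simp add: cobracket_dual_def pair_tensor_def fun_eq_iff algebra_simps)
  have scl: "?b (dual_scale c f) h = dual_scale c (?b f h)" "?b f (dual_scale c h) = dual_scale c (?b f h)"
    if "f \<in> V" "h \<in> V" for c f h
    using tensor_square_bilinear_scale[OF d bil[OF that], of _ c]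
    by (simp_all add: cobracket_dual_def pair_tensor_def fun_eq_iff dual_scale_def algebra_simps)
  have alt: "?b f f = 0" if "f \<in> V" for f
  proof
    fix x
    have sym: "(\<lambda>u v. f v * f u) = (\<lambda>u v. f u * f v)" by (simp add: fun_eq_iff mult.commute)
    have "?b f f x = - ?b f f x"
      using lie_coalgebraD(5)[OF co UNIV_I bil[OF that that], of x]
      unfolding sym cobracket_dual_def pair_tensor_def .
    then have "2 * ?b f f x = 0" unfolding mult_2 by (simp only: eq_neg_iff_add_eq_0)
    then show "?b f f x = 0 x" using two by simp
  qed
  have jac: "?b f (?b g h) + ?b g (?b h f) + ?b h (?b f g) = 0"
    if fgh: "f \<in> V" "g \<in> V" "h \<in> V" for f g h
  proof
    fix x
    have tri: "trilinear_form s UNIV (\<lambda>u v w. f u * g v * h w)"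
      unfolding trilinear_form_def using lin fgh by (auto intro!: linear_form_mult)
    have inner: "\<delta> v (\<lambda>w z. f u * g w * h z + f w * g z * h u + f z * g u * h w)
      = (f u * ?b g h v + h u * ?b f g v) + g u * ?b h f v" for u v
    proof -
      have "\<delta> v (\<lambda>w z. (f u * (g w * h z) + h u * (f w * g z)) + g u * (h w * f z))
        = (f u * ?b g h v + h u * ?b f g v) + g u * ?b h f v"
        unfolding cobracket_dual_def pair_tensor_def
        using fgh by (simp add: tensor_square_bilinear_add[OF d] tensor_square_bilinear_scale[OF d]
          bil bilinear_form_add bilinear_form_scale)
      then show ?thesis by (simp add: mult_ac)
    qed
    have "0 = \<delta> x (\<lambda>u v. (f u * ?b g h v + h u * ?b f g v) + g u * ?b h f v)"
      unfolding inner[symmetric] by (rule lie_coalgebraD(6)[OF co UNIV_I tri, symmetric])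
    also have "\<dots> = ?b f (?b g h) x + ?b h (?b f g) x + ?b g (?b h f) x"
      unfolding cobracket_dual_def[of \<delta> _ "?b _ _"] pair_tensor_def
      using fgh by (simp add: tensor_square_bilinear_add[OF d] bil closed bilinear_form_add)
    finally show "(?b f (?b g h) + ?b g (?b h f) + ?b h (?b f g)) x = 0 x"
      by (simp add: algebra_simps)
  qed
  show ?thesis
    unfolding lie_algebra_def
    by (intro conjI ballI allI vector_space_dual_scale V closed addl addr scl alt jac)
qed

text \<open>
  The co-Jacobi identity of \<open>\<Delta>\<close> involves an arbitrary trilinear form on \<open>V\<close>.  Only finitely many
  functionals occur in \<open>(id \<otimes> \<Delta>) (\<Delta> f)\<close>, so the form may be replaced by a combination of
  evaluations at triples of points, where the identity is \<open>f\<close> applied to the Jacobi identity.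
\<close>

lemma lie_coalgebra_dual:
  fixes V :: "('v::ab_group_add \<Rightarrow> 'k::field) set"
  assumes L: "lie_algebra s UNIV br"
    and V: "module.subspace dual_scale V" and lin: "\<And>f. f \<in> V \<Longrightarrow> linear_form s UNIV f"
    and mem: "\<And>f. f \<in> V \<Longrightarrow> \<Delta> f \<in> tensor_square dual_scale V"
    and eval: "\<And>f. f \<in> V \<Longrightarrow> eval_tensor (\<Delta> f) = (\<lambda>\<xi> \<eta>. f (br \<xi> \<eta>))"
  shows "lie_coalgebra dual_scale V \<Delta>"
proof -
  note vs = vector_space_dual_scale
  note sub = subspace_dual_scaleD[OF V]
  have addV: "f + g \<in> V" and sclV: "dual_scale c f \<in> V" if "f \<in> V" "g \<in> V" for f g c
    using sub(2,3) that by (simp_all add: plus_fun_def dual_scale_def)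
  have add: "\<Delta> (f + g) = \<Delta> f + \<Delta> g" if "f \<in> V" "g \<in> V" for f g
  proof (rule tensor_square_eqI[OF V])
    show "eval_tensor (\<Delta> (f + g)) = eval_tensor (\<Delta> f + \<Delta> g)"
      using fun_cong[OF fun_cong[OF eval[OF that(1)]]] fun_cong[OF fun_cong[OF eval[OF that(2)]]]
      unfolding eval[OF addV[OF that]]
      by (simp add: fun_eq_iff eval_tensor_def)
  qed (intro mem addV tensor_square_add that)+
  have scl: "\<Delta> (dual_scale c f) = (\<lambda>B. c * \<Delta> f B)" if "f \<in> V" for f c
  proof (rule tensor_square_eqI[OF V])
    show "eval_tensor (\<Delta> (dual_scale c f)) = eval_tensor (\<lambda>B. c * \<Delta> f B)"
      using fun_cong[OF fun_cong[OF eval[OF that]]] unfolding eval[OF sclV[OF that that]]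
      by (simp add: fun_eq_iff eval_tensor_def dual_scale_def)
  qed (rule mem[OF sclV[OF that that]], rule tensor_square_scale[OF vs V mem[OF that]])
  have linB: "linear_form dual_scale V (\<lambda>f. \<Delta> f B)" for B
    unfolding linear_form_def by (simp add: add scl)
  have skew: "\<Delta> f (\<lambda>u v. B v u) = - \<Delta> f B" if f: "f \<in> V" and B: "bilinear_form dual_scale V B" for f B
  proof -
    obtain r where r: "\<Delta> f = tensor_of dual_scale V r" "set r \<subseteq> V \<times> V"
      using mem[OF f] by (auto simp: tensor_square_def)
    let ?r = "map (\<lambda>(u, v). (dual_scale (- 1) v, u)) r"
    have r': "set ?r \<subseteq> V \<times> V" using r(2) sclV by auto
    have swap: "tensor_of dual_scale V ?r C = - \<Delta> f (\<lambda>u v. C v u)"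
      if C: "bilinear_form dual_scale V C" for C
      using r(2) unfolding r(1) tensor_of_bilinear[OF C] tensor_of_bilinear[OF bilinear_form_flip[OF C]]
      by (induction r) (auto simp: linear_formD(2)[OF bilinear_formD(1)[OF C]])
    have "tensor_of dual_scale V ?r = \<Delta> f"
    proof (rule tensor_square_eqI[OF V])
      show "tensor_of dual_scale V ?r \<in> tensor_square dual_scale V"
        unfolding tensor_square_def using r' by blast
      show "\<Delta> f \<in> tensor_square dual_scale V" by (rule mem[OF f])
      have "eval_tensor (tensor_of dual_scale V ?r) \<xi> \<eta> = - eval_tensor (\<Delta> f) \<eta> \<xi>" for \<xi> \<eta>
        unfolding eval_tensor_def swap[OF bilinear_form_evals] by (simp add: mult.commute)
      moreover have "- f (br \<eta> \<xi>) = f (br \<xi> \<eta>)" for \<xi> \<eta>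
        using linear_form_minus[OF lie_algebraD(1,2)[OF L] lin[OF f] UNIV_I, of "br \<eta> \<xi>"]
          lie_algebra_skew[OF L UNIV_I UNIV_I, of \<xi> \<eta>] by simp
      ultimately show "eval_tensor (tensor_of dual_scale V ?r) = eval_tensor (\<Delta> f)"
        by (simp add: fun_eq_iff eval[OF f])
    qed
    then show ?thesis using swap[OF B] by simp
  qed
  have jac: "\<Delta> f (\<lambda>u v. \<Delta> v (\<lambda>w z. T u w z + T w z u + T z u w)) = 0"
    if f: "f \<in> V" and T: "trilinear_form dual_scale V T" for f T
  proof -
    have "\<forall>f\<in>V. \<exists>r. \<Delta> f = tensor_of dual_scale V r \<and> set r \<subseteq> V \<times> V"
      using mem by (auto simp: tensor_square_def)
    then obtain r where r: "\<And>f. f \<in> V \<Longrightarrow> \<Delta> f = tensor_of dual_scale V (r f)"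
      "\<And>f. f \<in> V \<Longrightarrow> set (r f) \<subseteq> V \<times> V"
      by (metis bchoice)
    have rV: "u \<in> V" "v \<in> V" if "(u, v) \<in> set (r g)" "g \<in> V" for u v g
      using r(2)[OF that(2)] that(1) by auto
    have br: "(\<Sum>(u, v)\<leftarrow>r g. u \<xi> * v \<eta>) = g (br \<xi> \<eta>)" if "g \<in> V" for g \<xi> \<eta>
      using fun_cong[OF fun_cong[OF eval[OF that]], of \<xi> \<eta>]
      unfolding eval_tensor_def r(1)[OF that] tensor_of_bilinear[OF bilinear_form_evals] .
    \<comment> \<open>interpolation nodes for all functionals that occur in \<open>(id \<otimes> \<Delta>) (\<Delta> f)\<close>\<close>
    define gs where "gs = concat (map (\<lambda>(u, v). u # concat (map (\<lambda>(w, z). [w, z]) (r v))) (r f))"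
    have gs: "u \<in> set gs" "w \<in> set gs" "z \<in> set gs"
      if "(u, v) \<in> set (r f)" "(w, z) \<in> set (r v)" for u v w z
      using that unfolding gs_def by force+
    have "set gs \<subseteq> V" using rV f unfolding gs_def by force
    from ex_interpolation[OF V this] obtain ps where ps: "snd ` set ps \<subseteq> V"
      "\<forall>v\<in>set gs. interpolate ps v = v" by blast
    from trilinear_interpolate[OF V T ps(1)] obtain qs where qs:
      "\<forall>u\<in>V. \<forall>v\<in>V. \<forall>w\<in>V. interpolate ps u = u \<longrightarrow> interpolate ps v = v \<longrightarrow> interpolate ps w = w \<longrightarrow>
        T u v w = (\<Sum>(c, x, y, z)\<leftarrow>qs. c * (u x * v y * w z))" by blast
    let ?S = "\<lambda>u w z. T u w z + T w z u + T z u w"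
    have bilS: "bilinear_form dual_scale V (?S u)" if "u \<in> V" for u
      using trilinear_form_section[OF T that] by (intro bilinear_form_add) auto
    have bilT: "bilinear_form dual_scale V (\<lambda>u v. \<Delta> v (?S u))"
      unfolding bilinear_form_def
    proof (intro ballI conjI)
      fix v assume v: "v \<in> V"
      have "linear_form dual_scale V (\<lambda>u. \<Sum>(w, z)\<leftarrow>r v. ?S u w z)"
        unfolding split_def
        by (rule linear_form_sum_list)
          (use rV[OF _ v] in \<open>auto intro!: linear_form_add trilinear_formD[OF T]\<close>)
      moreover have "linear_form dual_scale V (\<lambda>u. \<Delta> v (?S u))
        \<longleftrightarrow> linear_form dual_scale V (\<lambda>u. \<Sum>(w, z)\<leftarrow>r v. ?S u w z)"
        unfolding linear_form_def r(1)[OF v] by (simp add: tensor_of_bilinear bilS addV sclV)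
      ultimately show "linear_form dual_scale V (\<lambda>u. \<Delta> v (?S u))" by simp
      show "linear_form dual_scale V (\<lambda>u. \<Delta> u (?S v))" by (rule linB)
    qed
    let ?E = "\<lambda>u w z x y t. u x * (w y * z t) + u t * (w x * z y) + u y * (w t * z x)"
    have "\<Delta> f (\<lambda>u v. \<Delta> v (?S u)) = (\<Sum>(u, v)\<leftarrow>r f. \<Delta> v (?S u))"
      unfolding r(1)[OF f] by (rule tensor_of_bilinear[OF bilT])
    also have "\<dots> = (\<Sum>(u, v)\<leftarrow>r f. \<Sum>(w, z)\<leftarrow>r v. \<Sum>(c, x, y, t)\<leftarrow>qs. c * ?E u w z x y t)"
    proof (rule sum_list_cong, clarify)
      fix u v assume uv: "(u, v) \<in> set (r f)"
      note uvV = rV[OF uv f]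
      have "\<Delta> v (?S u) = (\<Sum>(w, z)\<leftarrow>r v. ?S u w z)"
        unfolding r(1)[OF uvV(2)] by (rule tensor_of_bilinear[OF bilS[OF uvV(1)]])
      also have "\<dots> = (\<Sum>(w, z)\<leftarrow>r v. \<Sum>(c, x, y, t)\<leftarrow>qs. c * ?E u w z x y t)"
      proof (rule sum_list_cong, clarify)
        fix w z assume wz: "(w, z) \<in> set (r v)"
        note wzV = rV[OF wz uvV(2)]
        note fixed = bspec[OF ps(2) gs(1)[OF uv wz]] bspec[OF ps(2) gs(2)[OF uv wz]]
          bspec[OF ps(2) gs(3)[OF uv wz]]
        have "?S u w z = (\<Sum>(c, x, y, t)\<leftarrow>qs. c * (u x * w y * z t))
            + (\<Sum>(c, x, y, t)\<leftarrow>qs. c * (w x * z y * u t)) + (\<Sum>(c, x, y, t)\<leftarrow>qs. c * (z x * u y * w t))"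
          using qs uvV wzV fixed by simp
        also have "\<dots> = (\<Sum>(c, x, y, t)\<leftarrow>qs. c * ?E u w z x y t)"
          by (induction qs) (auto simp: algebra_simps)
        finally show "?S u w z = (\<Sum>(c, x, y, t)\<leftarrow>qs. c * ?E u w z x y t)" .
      qed
      finally show "\<Delta> v (?S u) = (\<Sum>(w, z)\<leftarrow>r v. \<Sum>(c, x, y, t)\<leftarrow>qs. c * ?E u w z x y t)" .
    qed
    also have "\<dots> = (\<Sum>(u, v)\<leftarrow>r f. \<Sum>(c, x, y, t)\<leftarrow>qs. \<Sum>(w, z)\<leftarrow>r v. c * ?E u w z x y t)"
      unfolding split_def by (subst sum_list_swap) (rule refl)
    also have "\<dots> = (\<Sum>(c, x, y, t)\<leftarrow>qs. \<Sum>(u, v)\<leftarrow>r f. \<Sum>(w, z)\<leftarrow>r v. c * ?E u w z x y t)"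
      unfolding split_def by (subst sum_list_swap) (rule refl)
    also have "\<dots> = (\<Sum>(c, x, y, t)\<leftarrow>qs. 0)"
    proof (rule sum_list_cong, clarify)
      fix c x y t
      have "(\<Sum>(u, v)\<leftarrow>r f. \<Sum>(w, z)\<leftarrow>r v. c * ?E u w z x y t)
        = (\<Sum>(u, v)\<leftarrow>r f. c * (u x * v (br y t) + u t * v (br x y) + u y * v (br t x)))"
      proof (rule sum_list_cong, clarify)
        fix u v assume uv: "(u, v) \<in> set (r f)"
        have "(\<Sum>(w, z)\<leftarrow>rs. c * ?E u w z x y t) = c * (u x * (\<Sum>(w, z)\<leftarrow>rs. w y * z t)
          + u t * (\<Sum>(w, z)\<leftarrow>rs. w x * z y) + u y * (\<Sum>(w, z)\<leftarrow>rs. w t * z x))" for rs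
          by (induction rs) (auto simp: algebra_simps)
        then show "(\<Sum>(w, z)\<leftarrow>r v. c * ?E u w z x y t)
          = c * (u x * v (br y t) + u t * v (br x y) + u y * v (br t x))"
          by (simp add: br[OF rV(2)[OF uv f]])
      qed
      also have "\<dots> = c * ((\<Sum>(u, v)\<leftarrow>r f. u x * v (br y t)) + (\<Sum>(u, v)\<leftarrow>r f. u t * v (br x y))
          + (\<Sum>(u, v)\<leftarrow>r f. u y * v (br t x)))"
        by (simp add: split_def sum_list_addf sum_list_const_mult)
      also have "\<dots> = c * (f (br x (br y t)) + f (br t (br x y)) + f (br y (br t x)))"
        by (simp only: br[OF f])
      also have "\<dots> = c * f (br x (br y t) + br y (br t x) + br t (br x y))"
        by (simp add: linear_formD(1)[OF lin[OF f]] algebra_simps)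
      also have "\<dots> = 0"
        using lie_algebraD(9)[OF L, of x y t] linear_form_zero[OF lie_algebraD(1,2)[OF L] lin[OF f]]
        by simp
      finally show "(\<Sum>(u, v)\<leftarrow>r f. \<Sum>(w, z)\<leftarrow>r v. c * ?E u w z x y t) = 0" .
    qed
    also have "\<dots> = 0" by (induction qs) auto
    finally show ?thesis .
  qed
  show ?thesis
    unfolding lie_coalgebra_def
    by (intro conjI ballI allI impI vs V mem linB skew jac)
qed

text \<open>The compatibility of bracket and cobracket is self-dual.\<close>

lemma lie_bialgebra_dual:
  fixes V :: "('v::ab_group_add \<Rightarrow> 'k::field) set"
  assumes bi: "lie_bialgebra s UNIV br \<delta>" and two: "(2 :: 'k) \<noteq> 0"
    and V: "module.subspace dual_scale V" and lin: "\<And>f. f \<in> V \<Longrightarrow> linear_form s UNIV f"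
    and closed: "\<And>f h. f \<in> V \<Longrightarrow> h \<in> V \<Longrightarrow> cobracket_dual \<delta> f h \<in> V"
    and mem: "\<And>f. f \<in> V \<Longrightarrow> \<Delta> f \<in> tensor_square dual_scale V"
    and eval: "\<And>f. f \<in> V \<Longrightarrow> eval_tensor (\<Delta> f) = (\<lambda>\<xi> \<eta>. f (br \<xi> \<eta>))"
  shows "lie_bialgebra dual_scale V (cobracket_dual \<delta>) \<Delta>"
proof -
  let ?b = "cobracket_dual \<delta>"
  have L: "lie_algebra s UNIV br" and co: "lie_coalgebra s UNIV \<delta>"
    and cocycle: "\<And>x y. \<delta> (br x y) = tensor_act s UNIV br x (\<delta> y) - tensor_act s UNIV br y (\<delta> x)"
    using bi by (auto simp: lie_bialgebra_def)
  have LV: "lie_algebra dual_scale V ?b" by (rule lie_algebra_dual[OF co two V lin closed])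
  have coV: "lie_coalgebra dual_scale V \<Delta>" by (rule lie_coalgebra_dual[OF L V lin mem eval])
  have "\<forall>x. \<exists>r. \<delta> x = tensor_of s UNIV r"
    using lie_coalgebraD(3)[OF co UNIV_I] unfolding tensor_square_def by blast
  then obtain d where d: "\<And>x. \<delta> x = tensor_of s UNIV (d x)"
    using choice[of "\<lambda>x r. \<delta> x = tensor_of s UNIV r"] by blast
  have bil: "bilinear_form s UNIV (\<lambda>x y. f x * g y)" if "linear_form s UNIV f" "linear_form s UNIV g" for f g
    by (rule bilinear_form_mult) (use that in auto)
  have ad: "linear_form s UNIV (\<lambda>x. f (br x \<xi>))" "linear_form s UNIV (\<lambda>x. f (br \<xi> x))" if "f \<in> V" for f \<xi>
    using lie_algebraD(4-7)[OF L] linear_formD[OF lin[OF that]] by (auto simp: linear_form_def)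
  have b: "?b f h x = (\<Sum>(u, v)\<leftarrow>d x. f u * h v)" if "f \<in> V" "h \<in> V" for f h x
    unfolding cobracket_dual_def pair_tensor_def d
    by (rule tensor_of_bilinear[OF bil]) (use that lin in auto)
  have compat: "\<Delta> (?b f h) = tensor_act dual_scale V ?b f (\<Delta> h) - tensor_act dual_scale V ?b h (\<Delta> f)"
    if fh: "f \<in> V" "h \<in> V" for f h
  proof (rule tensor_square_eqI[OF V])
    show "\<Delta> (?b f h) \<in> tensor_square dual_scale V" by (rule mem[OF closed[OF fh]])
    show "tensor_act dual_scale V ?b f (\<Delta> h) - tensor_act dual_scale V ?b h (\<Delta> f)
      \<in> tensor_square dual_scale V"
      by (intro tensor_square_diff vector_space_dual_scale V tensor_act_in_tensor_square[OF LV] mem fh)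
    \<comment> \<open>the action on \<open>\<Delta> k\<close>, evaluated at a pair of points, is a sum over \<open>\<delta> \<xi>\<close> and \<open>\<delta> \<eta>\<close>\<close>
    have act: "eval_tensor (tensor_act dual_scale V ?b g (\<Delta> k)) \<xi> \<eta>
      = (\<Sum>(u, v)\<leftarrow>d \<xi>. g u * k (br v \<eta>)) + (\<Sum>(u, v)\<leftarrow>d \<eta>. g u * k (br \<xi> v))"
      if g: "g \<in> V" and k: "k \<in> V" for g k \<xi> \<eta>
    proof -
      obtain r where r: "\<Delta> k = tensor_of dual_scale V r" "set r \<subseteq> V \<times> V"
        using mem[OF k] by (auto simp: tensor_square_def)
      have rk: "(\<Sum>(p, q)\<leftarrow>r. p x * q y) = k (br x y)" for x y
        using fun_cong[OF fun_cong[OF eval[OF k]], of x y]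
        unfolding eval_tensor_def r(1) tensor_of_bilinear[OF bilinear_form_evals] .
      have "eval_tensor (tensor_act dual_scale V ?b g (\<Delta> k)) \<xi> \<eta>
        = (\<Sum>(p, q)\<leftarrow>r. ?b g p \<xi> * q \<eta> + p \<xi> * ?b g q \<eta>)"
        unfolding eval_tensor_def r(1)
        by (rule tensor_act_tensor_of[OF LV g bilinear_form_evals])
      also have "\<dots> = (\<Sum>pq\<leftarrow>r. \<Sum>uv\<leftarrow>d \<xi>. g (fst uv) * (fst pq (snd uv) * snd pq \<eta>))
        + (\<Sum>pq\<leftarrow>r. \<Sum>uv\<leftarrow>d \<eta>. g (fst uv) * (fst pq \<xi> * snd pq (snd uv)))"
        unfolding sum_list_addf[symmetric]
      proof (rule sum_list_cong)
        fix pq assume "pq \<in> set r"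
        then have pq: "fst pq \<in> V" "snd pq \<in> V" using r(2) by auto
        show "(case pq of (p, q) \<Rightarrow> ?b g p \<xi> * q \<eta> + p \<xi> * ?b g q \<eta>)
          = (\<Sum>uv\<leftarrow>d \<xi>. g (fst uv) * (fst pq (snd uv) * snd pq \<eta>))
          + (\<Sum>uv\<leftarrow>d \<eta>. g (fst uv) * (fst pq \<xi> * snd pq (snd uv)))"
          by (simp add: split_def b g pq mult_ac flip: sum_list_const_mult)
      qed
      also have "\<dots> = (\<Sum>uv\<leftarrow>d \<xi>. \<Sum>pq\<leftarrow>r. g (fst uv) * (fst pq (snd uv) * snd pq \<eta>))
        + (\<Sum>uv\<leftarrow>d \<eta>. \<Sum>pq\<leftarrow>r. g (fst uv) * (fst pq \<xi> * snd pq (snd uv)))"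
        by (subst (1 2) sum_list_swap) (rule refl)
      also have "\<dots> = (\<Sum>(u, v)\<leftarrow>d \<xi>. g u * k (br v \<eta>)) + (\<Sum>(u, v)\<leftarrow>d \<eta>. g u * k (br \<xi> v))"
        by (simp add: split_def sum_list_const_mult rk[symmetric])
      finally show ?thesis .
    qed
    \<comment> \<open>by skew-symmetry of the cobracket, the two factors may be exchanged\<close>
    have sw: "(\<Sum>(u, v)\<leftarrow>d x. p u * q v) = - (\<Sum>(u, v)\<leftarrow>d x. q u * p v)"
      if "linear_form s UNIV p" "linear_form s UNIV q" for p q x
      using lie_coalgebraD(5)[OF co UNIV_I bil[OF that], of x]
      unfolding d tensor_of_bilinear[OF bilinear_form_flip[OF bil[OF that]]] tensor_of_bilinear[OF bil[OF that]]
      by (simp add: mult.commute eq_neg_iff_add_eq_0 add.commute)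
    have neg: "k (br x y) = - k (br y x)" if "k \<in> V" for k x y
      using linear_form_minus[OF lie_algebraD(1,2)[OF L] lin[OF that] UNIV_I, of "br y x"]
        lie_algebra_skew[OF L UNIV_I UNIV_I, of x y] by simp
    show "eval_tensor (\<Delta> (?b f h))
      = eval_tensor (tensor_act dual_scale V ?b f (\<Delta> h) - tensor_act dual_scale V ?b h (\<Delta> f))"
    proof (intro ext)
      fix \<xi> \<eta>
      have "eval_tensor (\<Delta> (?b f h)) \<xi> \<eta> = \<delta> (br \<xi> \<eta>) (\<lambda>x y. f x * h y)"
        by (simp add: eval[OF closed[OF fh]] cobracket_dual_def pair_tensor_def)
      also have "\<dots> = (\<Sum>(u, v)\<leftarrow>d \<eta>. f (br \<xi> u) * h v + f u * h (br \<xi> v))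
          - (\<Sum>(u, v)\<leftarrow>d \<xi>. f (br \<eta> u) * h v + f u * h (br \<eta> v))"
        unfolding cocycle fun_diff_def unfolding d
        using bil[OF lin[OF fh(1)] lin[OF fh(2)]] by (simp add: tensor_act_tensor_of[OF L UNIV_I])
      also have "\<dots> = ((\<Sum>(u, v)\<leftarrow>d \<eta>. f (br \<xi> u) * h v) + (\<Sum>(u, v)\<leftarrow>d \<eta>. f u * h (br \<xi> v)))
          - ((\<Sum>(u, v)\<leftarrow>d \<xi>. f (br \<eta> u) * h v) + (\<Sum>(u, v)\<leftarrow>d \<xi>. f u * h (br \<eta> v)))"
        by (simp add: split_def sum_list_addf)
      also have "\<dots> = ((\<Sum>(u, v)\<leftarrow>d \<eta>. f u * h (br \<xi> v)) - (\<Sum>(u, v)\<leftarrow>d \<xi>. f u * h (br \<eta> v)))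
          - ((\<Sum>(u, v)\<leftarrow>d \<eta>. h u * f (br \<xi> v)) - (\<Sum>(u, v)\<leftarrow>d \<xi>. h u * f (br \<eta> v)))"
        unfolding sw[OF ad(2)[OF fh(1)] lin[OF fh(2)]] by simp
      also have "\<dots> = eval_tensor (tensor_act dual_scale V ?b f (\<Delta> h)) \<xi> \<eta>
          - eval_tensor (tensor_act dual_scale V ?b h (\<Delta> f)) \<xi> \<eta>"
        unfolding act[OF fh] act[OF fh(2,1)] neg[OF fh(1), of _ \<eta>] neg[OF fh(2), of _ \<eta>]
        by (simp add: split_def sum_list_minus)
      finally show "eval_tensor (\<Delta> (?b f h)) \<xi> \<eta>
        = eval_tensor (tensor_act dual_scale V ?b f (\<Delta> h) - tensor_act dual_scale V ?b h (\<Delta> f)) \<xi> \<eta>"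
        by (simp add: eval_tensor_def)
    qed
  qed
  show ?thesis
    unfolding lie_bialgebra_def using LV coV compat by blast
qed

section \<open>Triangular structures on two-dimensional subalgebras\<close>

lemma lie_algebra_right_zero_minus:
  assumes L: "lie_algebra s V br" and "y \<in> V" "z \<in> V"
  shows "br z 0 = 0" "br z (- y) = - br z y"
proof -
  interpret vector_space s by (rule lie_algebraD(1)[OF L])
  show "br z 0 = 0" using lie_algebraD(7)[OF L assms(3,2), of 0] by simp
  show "br z (- y) = - br z y" using lie_algebraD(7)[OF L assms(3,2), of "- 1"] by simp
qed

text \<open>
  The list \<open>[(a, b), (- b, a)]\<close> represents \<open>a \<otimes> b - b \<otimes> a\<close>.
\<close>

lemma coboundary_wedge:
  assumes L: "lie_algebra s UNIV br" and B: "bilinear_form s UNIV B"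
  shows "coboundary s br [(a, b), (- b, a)] z B =
    B (br z a) b + B a (br z b) - B (br z b) a - B b (br z a)"
proof -
  have neg: "br z (- b) = - br z b"
    by (rule lie_algebra_right_zero_minus(2)[OF L UNIV_I UNIV_I])
  have Bneg: "B (- x) y = - B x y" for x y
    by (rule linear_form_minus[OF lie_algebraD(1,2)[OF L] bilinear_formD(1)[OF B UNIV_I] UNIV_I])
  show ?thesis
    unfolding coboundary_def tensor_act_tensor_of[OF L UNIV_I B] by (simp add: neg Bneg)
qed

lemma coboundary_in_tensor_square:
  assumes "lie_algebra s UNIV br"
  shows "coboundary s br r z \<in> tensor_square s UNIV"
  unfolding coboundary_def
  by (rule tensor_act_in_tensor_square[OF assms]) (auto simp: tensor_square_def)

lemma coboundary_cocycle:
  assumes L: "lie_algebra s UNIV br"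
  shows "coboundary s br r (br x y)
    = tensor_act s UNIV br x (coboundary s br r y) - tensor_act s UNIV br y (coboundary s br r x)"
proof
  fix B
  show "coboundary s br r (br x y) B
    = (tensor_act s UNIV br x (coboundary s br r y) - tensor_act s UNIV br y (coboundary s br r x)) B"
  proof (cases "bilinear_form s UNIV B")
    case False
    then show ?thesis by (simp add: coboundary_def tensor_act_def)
  next
    case B: True
    let ?B = "\<lambda>z u v. B (br z u) v + B u (br z v)"
    have act: "tensor_act s UNIV br z (coboundary s br r w) B
      = (\<Sum>(u, v)\<leftarrow>r. ?B z (br w u) v + ?B z u (br w v))" for z w
    proof -
      have "tensor_act s UNIV br z (coboundary s br r w) B = coboundary s br r w (?B z)"
        by (simp add: tensor_act_def B)
      also have "\<dots> = (\<Sum>(u, v)\<leftarrow>r. ?B z (br w u) v + ?B z u (br w v))"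
        unfolding coboundary_def by (rule tensor_act_tensor_of[OF L UNIV_I bilinear_form_act[OF L UNIV_I B]])
      finally show ?thesis .
    qed
    have jac: "br (br x y) u = br x (br y u) - br y (br x u)" for u
    proof -
      have "br (br x y) u = - br u (br x y)" by (rule lie_algebra_skew[OF L UNIV_I UNIV_I])
      also have "br u (br x y) = - (br x (br y u) + br y (br u x))"
        unfolding eq_neg_iff_add_eq_0
        using lie_algebraD(9)[OF L UNIV_I UNIV_I UNIV_I, of x y u] by (simp add: add.commute)
      also have "br y (br u x) = - br y (br x u)"
        unfolding lie_algebra_skew[OF L UNIV_I UNIV_I, of u x]
        by (rule lie_algebra_right_zero_minus(2)[OF L UNIV_I UNIV_I])
      finally show ?thesis by simp
    qed
    have diff: "B (p - q) v = B p v - B q v" "B v (p - q) = B v p - B v q" for p q v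
      using linear_formD(1)[OF bilinear_formD(1)[OF B UNIV_I] UNIV_I UNIV_I, of "p - q" q v]
        linear_formD(1)[OF bilinear_formD(2)[OF B UNIV_I] UNIV_I UNIV_I, of v "p - q" q] by simp_all
    have "coboundary s br r (br x y) B
      = (\<Sum>(u, v)\<leftarrow>r. (?B x (br y u) v + ?B x u (br y v)) - (?B y (br x u) v + ?B y u (br x v)))"
      unfolding coboundary_def tensor_act_tensor_of[OF L UNIV_I B] jac diff
      by (simp add: algebra_simps)
    also have "\<dots> = (tensor_act s UNIV br x (coboundary s br r y)
      - tensor_act s UNIV br y (coboundary s br r x)) B"
      unfolding fun_diff_def act split_def sum_list_subtractf by (rule refl)
    finally show ?thesis .
  qed
qed

text \<open>
  If \<open>[a, b]\<close> is a multiple of \<open>b\<close>, then \<open>a \<and> b\<close> is a triangular r-matrix.  The co-Jacobi identity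
  and the Yang-Baxter equation are verified by expansion.
\<close>

lemma lie_bialgebra_wedge:
  fixes a b :: "'v::ab_group_add"
  assumes L: "lie_algebra s UNIV br" and ab: "br a b = s c b"
  shows "lie_bialgebra s UNIV br (coboundary s br [(a, b), (- b, a)])"
proof -
  let ?d = "coboundary s br [(a, b), (- b, a)]"
  interpret vector_space s by (rule lie_algebraD(1)[OF L])
  note br = lie_algebraD(4-7)[OF L UNIV_I UNIV_I] lie_algebraD(4,5)[OF L UNIV_I UNIV_I UNIV_I]
  note d = coboundary_wedge[OF L]
  have br0: "br x x = 0" for x by (rule lie_algebraD(8)[OF L UNIV_I])
  have ba: "br b a = s (- c) b"
    using lie_algebra_skew[OF L UNIV_I UNIV_I, of b a] ab by simp
  have lin: "linear_form s UNIV (\<lambda>x. ?d x B)" if B: "bilinear_form s UNIV B" for B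
    unfolding linear_form_def d[OF B]
    by (simp add: br linear_formD[OF bilinear_formD(1)[OF B]] linear_formD[OF bilinear_formD(2)[OF B]]
      algebra_simps)
  have skew: "?d x (\<lambda>u v. B v u) = - ?d x B" if B: "bilinear_form s UNIV B" for x B
    unfolding d[OF B] d[OF bilinear_form_flip[OF B]] by simp
  have jac: "?d x (\<lambda>u v. ?d v (\<lambda>w z. T u w z + T w z u + T z u w)) = 0"
    if T: "trilinear_form s UNIV T" for x T
  proof -
    \<comment> \<open>the cyclic symmetrization, whose invariance under rotation makes the terms cancel\<close>
    define S where "S = (\<lambda>u w z. T u w z + T w z u + T z u w)"
    have cyc: "S u w z = S w z u" for u w z by (simp add: S_def)
    note trl = linear_formD[OF trilinear_formD(1)[OF T UNIV_I UNIV_I] UNIV_I]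
      linear_formD[OF trilinear_formD(2)[OF T UNIV_I UNIV_I] UNIV_I]
      linear_formD[OF trilinear_formD(3)[OF T UNIV_I UNIV_I] UNIV_I]
    have addS: "S (u + u') w z = S u w z + S u' w z" "S u (w + w') z = S u w z + S u w' z"
      "S u w (z + z') = S u w z + S u w z'"
      and sclS: "S (s k u) w z = k * S u w z" "S u (s k w) z = k * S u w z" "S u w (s k z) = k * S u w z"
      for u u' w w' z z' k
      unfolding S_def by (simp_all add: trl algebra_simps)
    have zeroS: "S u 0 z = 0" "S u w 0 = 0" for u w z
      using sclS(2)[of u 0 0 z] sclS(3)[of u w 0 0] by simp_all
    have bilS: "bilinear_form s UNIV (S u)" for u
      by (auto simp: bilinear_form_def linear_form_def addS sclS)
    have bilD: "bilinear_form s UNIV (\<lambda>u v. ?d v (S u))"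
      unfolding bilinear_form_def
    proof (intro ballI conjI)
      fix v
      show "linear_form s UNIV (\<lambda>u. ?d v (S u))"
        unfolding d[OF bilS] by (simp add: linear_form_def addS sclS algebra_simps)
      show "linear_form s UNIV (\<lambda>u. ?d u (S v))" by (rule lin[OF bilS])
    qed
    define A B where "A = br x a" and "B = br x b"
    have Ab: "br A b = br B a + s c B"
    proof -
      have "br x (br a b) + br a (br b x) + br b (br x a) = 0"
        by (rule lie_algebraD(9)[OF L UNIV_I UNIV_I UNIV_I])
      moreover have "br x (br a b) = s c B" unfolding ab B_def by (rule br(4))
      moreover have "br b (br x a) = - br A b"
        unfolding A_def by (rule lie_algebra_skew[OF L UNIV_I UNIV_I])
      moreover have "br a (br b x) = br B a"
      proof -
        have "br b x = s (- 1) B"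
          using lie_algebra_skew[OF L UNIV_I UNIV_I, of b x] by (simp add: B_def)
        then have "br a (br b x) = - br a B"
          by (simp add: lie_algebra_right_zero_minus(2)[OF L UNIV_I UNIV_I])
        also have "\<dots> = br B a" using lie_algebra_skew[OF L UNIV_I UNIV_I, of B a] by simp
        finally show ?thesis .
      qed
      ultimately have "s c B + br B a - br A b = 0" by simp
      then show ?thesis by (simp add: add.commute)
    qed
    have "?d x (\<lambda>u v. ?d v (S u)) = ?d b (S A) + ?d B (S a) - ?d a (S B) - ?d A (S b)"
      unfolding d[OF bilD] A_def B_def ..
    also have "\<dots> = 0"
      unfolding d[OF bilS] ab ba br0 zeroS Ab addS sclS
      \<comment> \<open>rotate every term so that \<open>a\<close> and \<open>b\<close> come first\<close>
      using cyc[of a "br B b" a] cyc[of "br B b" a a] cyc[of b "br A a" b] cyc[of "br A a" b b]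
        cyc[of a "br B a" b] cyc[of "br B a" a b] cyc[of b "br B a" a] cyc[of "br B a" b a]
        cyc[of a B b] cyc[of B a b] cyc[of b B a] cyc[of B b a]
      by (simp add: algebra_simps)
    finally show ?thesis by (simp add: S_def)
  qed
  have "lie_coalgebra s UNIV ?d"
    unfolding lie_coalgebra_def
    using vector_space_axioms coboundary_in_tensor_square[OF L] lin skew jac by simp
  then show ?thesis
    unfolding lie_bialgebra_def using L coboundary_cocycle[OF L] by blast
qed

lemma two_sided_ideal_mult:
  fixes S :: "'a::ring_1 set"
  assumes "x \<in> two_sided_ideal S"
  shows "u * x * v \<in> two_sided_ideal S"
  using assms
proof (induction rule: two_sided_ideal.induct)
  case zero
  then show ?case by (simp add: two_sided_ideal.zero)
next
  case (add a b)
  then show ?case by (simp add: distrib_left distrib_right two_sided_ideal.add)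
next
  case (gen g u' v')
  have "u * (u' * g * v') * v = (u * u') * g * (v' * v)" by (simp add: mult.assoc)
  then show ?case using two_sided_ideal.gen[OF gen] by simp
qed

text \<open>Congruence modulo the two-sided ideal generated by \<open>S\<close>, that is, equality in the quotient ring.\<close>

definition ideal_cong :: "'a::ring_1 set \<Rightarrow> 'a \<Rightarrow> 'a \<Rightarrow> bool" where
  "ideal_cong S x y \<longleftrightarrow> x - y \<in> two_sided_ideal S"

lemma ideal_cong_refl: "ideal_cong S x x"
  by (simp add: ideal_cong_def two_sided_ideal.zero)

lemma ideal_cong_add:
  assumes "ideal_cong S x y" "ideal_cong S x' y'"
  shows "ideal_cong S (x + x') (y + y')"
  using two_sided_ideal.add[OF assms[unfolded ideal_cong_def]] by (simp add: ideal_cong_def algebra_simps)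

lemma ideal_cong_mult:
  assumes "ideal_cong S x y" "ideal_cong S x' y'"
  shows "ideal_cong S (x * x') (y * y')"
proof -
  have "x * x' - y * y' = 1 * (x - y) * x' + y * (x' - y') * 1" by (simp add: algebra_simps)
  then show ?thesis
    using assms unfolding ideal_cong_def by (simp only: two_sided_ideal.add two_sided_ideal_mult)
qed

lemma ideal_cong_diff:
  assumes "ideal_cong S x y" "ideal_cong S x' y'"
  shows "ideal_cong S (x - x') (y - y')"
  using ideal_cong_add[OF assms(1) ideal_cong_mult[OF ideal_cong_refl assms(2)], of "- 1"]
  by (simp add: ideal_cong_def)

lemma ideal_cong_trans:
  assumes "ideal_cong S x y" "ideal_cong S y z"
  shows "ideal_cong S x z"
  using two_sided_ideal.add[OF assms[unfolded ideal_cong_def]] by (simp add: ideal_cong_def)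

lemma ideal_cong_gen: "x - y \<in> S \<Longrightarrow> ideal_cong S x y"
  using two_sided_ideal.gen[of "x - y" S 1 1] by (simp add: ideal_cong_def)

lemma cybe_wedge:
  fixes s :: "'k::field \<Rightarrow> 'v::ab_group_add \<Rightarrow> 'v"
  assumes vs: "vector_space s" and ab: "br a b = s c b"
  shows "cybe s br [(a, b), (- b, a)]"
proof -
  interpret vector_space s by fact
  let ?S = "uea_relators s br slot1 \<union> uea_relators s br slot2 \<union> uea_relators s br slot3"
  let ?C = "Poly_Mapping.single 0 c :: ('k, 'v) free_cube"
  note relators = uea_relators_def
  have neg: "ideal_cong ?S (w (- b)) (- w b)" if "w = slot1 \<or> w = slot2 \<or> w = slot3" for w
  proof (rule ideal_cong_gen)
    have "w (- b) - - w b = w (s (- 1) b) - Poly_Mapping.single 0 (- 1) * w b"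
      by (simp add: single_uminus)
    then show "w (- b) - - w b \<in> ?S"
      using that unfolding relators by blast
  qed
  have scl: "ideal_cong ?S (w (s c b)) (?C * w b)" if "w = slot1 \<or> w = slot2 \<or> w = slot3" for w
    by (rule ideal_cong_gen) (use that in \<open>unfold relators; blast\<close>)
  have br: "ideal_cong ?S (w a * w b - w b * w a) (?C * w b)" if w: "w = slot1 \<or> w = slot2 \<or> w = slot3" for w
  proof (rule ideal_cong_trans[OF _ scl[OF w]])
    show "ideal_cong ?S (w a * w b - w b * w a) (w (s c b))"
      by (rule ideal_cong_gen) (use w in \<open>unfold relators ab[symmetric]; blast\<close>)
  qed
  let ?c = "\<lambda>x y. x * y - y * x :: ('k, 'v) free_cube"
  \<comment> \<open>In \<open>?E\<close>, the arguments stand for the images of \<open>- b\<close> in the first two factors; \<open>?F\<close> collects the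
    commutators within a single factor, as different factors commute.\<close>
  let ?E = "\<lambda>n1 n2 :: ('k, 'v) free_cube.
    ?c (slot1 a * slot2 b + n1 * slot2 a) (slot1 a * slot3 b + n1 * slot3 a) +
    ?c (slot1 a * slot2 b + n1 * slot2 a) (slot2 a * slot3 b + n2 * slot3 a) +
    ?c (slot1 a * slot3 b + n1 * slot3 a) (slot2 a * slot3 b + n2 * slot3 a)"
  let ?F = "\<lambda>k1 k2 k3 :: ('k, 'v) free_cube.
    k1 * (slot2 a * slot3 b) - k1 * (slot2 b * slot3 a)
    + slot1 b * k2 * slot3 a - slot1 a * k2 * slot3 b
    + slot1 a * slot2 b * k3 - slot1 b * slot2 a * k3"
  note expand = slot1_def slot2_def slot3_def mult_single
  have "ideal_cong ?S (?E (slot1 (- b)) (slot2 (- b))) (?E (- slot1 b) (- slot2 b))"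
    by (intro ideal_cong_add ideal_cong_diff ideal_cong_mult ideal_cong_refl neg) auto
  also have "?E (- slot1 b) (- slot2 b) = ?F (?c (slot1 a) (slot1 b)) (?c (slot2 a) (slot2 b)) (?c (slot3 a) (slot3 b))"
    by (simp add: expand distrib_left distrib_right left_diff_distrib right_diff_distrib)
  finally have 1: "ideal_cong ?S (?E (slot1 (- b)) (slot2 (- b)))
    (?F (?c (slot1 a) (slot1 b)) (?c (slot2 a) (slot2 b)) (?c (slot3 a) (slot3 b)))" .
  have "ideal_cong ?S (?F (?c (slot1 a) (slot1 b)) (?c (slot2 a) (slot2 b)) (?c (slot3 a) (slot3 b)))
    (?F (?C * slot1 b) (?C * slot2 b) (?C * slot3 b))"
    by (intro ideal_cong_add ideal_cong_diff ideal_cong_mult ideal_cong_refl br) auto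
  also have "?F (?C * slot1 b) (?C * slot2 b) (?C * slot3 b) = 0"
    by (simp add: expand algebra_simps)
  finally have "ideal_cong ?S (?E (slot1 (- b)) (slot2 (- b))) 0"
    by (rule ideal_cong_trans[OF 1])
  then show ?thesis
    by (simp add: cybe_def uea_cube_ideal_def Let_def ideal_cong_def)
qed

section \<open>The twisted Heisenberg-Virasoro algebra\<close>

lemma laurent_sum_singles:
  fixes f :: "'k::field laurent"
  shows "f = (\<Sum>n\<in>Poly_Mapping.keys f. Poly_Mapping.single n (Poly_Mapping.lookup f n))"
proof (rule poly_mapping_eqI)
  fix k
  have "(\<Sum>n\<in>Poly_Mapping.keys f. Poly_Mapping.lookup (Poly_Mapping.single n (Poly_Mapping.lookup f n)) k)
    = (\<Sum>n\<in>Poly_Mapping.keys f. if k = n then Poly_Mapping.lookup f k else 0)"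
    by (intro sum.cong) (auto simp: lookup_single when_def)
  then show "Poly_Mapping.lookup f k
    = Poly_Mapping.lookup (\<Sum>n\<in>Poly_Mapping.keys f. Poly_Mapping.single n (Poly_Mapping.lookup f n)) k"
    by (simp add: lookup_sum in_keys_iff)
qed

lemma laurent_induct [case_names single add]:
  fixes f :: "'k::field laurent"
  assumes single: "\<And>n c. P (Poly_Mapping.single n c)" and add: "\<And>f g. P f \<Longrightarrow> P g \<Longrightarrow> P (f + g)"
  shows "P f"
proof -
  have "P (\<Sum>n\<in>A. Poly_Mapping.single n (c n))" if "finite A" for A c
    using that
  proof (induction A)
    case empty
    show ?case using single[of 0 0] by simp
  next
    case (insert n A)
    then show ?case by (simp add: add single)
  qed
  then show ?thesis using laurent_sum_singles[of f] by (metis finite_keys)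
qed

lemma lookup_laurent_scale: "Poly_Mapping.lookup (laurent_scale c f) n = c * Poly_Mapping.lookup f n"
  by (simp add: laurent_scale_def Poly_Mapping.map.rep_eq when_def)

lemma laurent_scale_conv_mult: "laurent_scale c f = Poly_Mapping.single 0 c * f"
  by (simp add: laurent_scale_def mult_map_scale_conv_mult)

lemma laurent_scale_single: "laurent_scale c (Poly_Mapping.single n d) = Poly_Mapping.single n (c * d)"
  by (simp add: laurent_scale_conv_mult mult_single)

lemma lookup_laurent_deriv:
  "Poly_Mapping.lookup (laurent_deriv f) n = of_int (n + 1) * Poly_Mapping.lookup f (n + 1)"
proof -
  have "Poly_Mapping.lookup (laurent_deriv f) n
    = (\<Sum>k\<in>Poly_Mapping.keys f. if n + 1 = k then of_int (n + 1) * Poly_Mapping.lookup f (n + 1) else 0)"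
    unfolding laurent_deriv_def lookup_sum
    by (intro sum.cong) (auto simp: lookup_single when_def)
  then show ?thesis by (auto simp: in_keys_iff)
qed

lemma laurent_scale_zero: "laurent_scale c 0 = 0"
  by (simp add: laurent_scale_conv_mult)

lemma laurent_deriv_single: "laurent_deriv (Poly_Mapping.single n c) = Poly_Mapping.single (n - 1) (of_int n * c)"
  by (rule poly_mapping_eqI) (auto simp: lookup_laurent_deriv lookup_single when_def)

lemma laurent_deriv_add: "laurent_deriv (f + g) = laurent_deriv f + laurent_deriv g"
  by (rule poly_mapping_eqI) (simp add: lookup_laurent_deriv lookup_add algebra_simps)

lemma laurent_deriv_diff: "laurent_deriv (f - g) = laurent_deriv f - laurent_deriv g"
  by (rule poly_mapping_eqI) (simp add: lookup_laurent_deriv lookup_minus algebra_simps)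

lemma laurent_deriv_zero: "laurent_deriv 0 = 0"
  by (rule poly_mapping_eqI) (simp add: lookup_laurent_deriv)

lemma laurent_deriv_scale: "laurent_deriv (laurent_scale c f) = laurent_scale c (laurent_deriv f)"
  by (rule poly_mapping_eqI) (simp add: lookup_laurent_deriv lookup_laurent_scale)

lemma laurent_deriv_mult: "laurent_deriv (f * g) = laurent_deriv f * g + f * laurent_deriv g"
proof (induction f rule: laurent_induct)
  case (single n c)
  show ?case
  proof (induction g rule: laurent_induct)
    case (single k d)
    show ?case
      by (simp add: mult_single laurent_deriv_single algebra_simps flip: single_add)
  next
    case (add g h)
    then show ?case by (simp add: laurent_deriv_add distrib_left)
  qed
next
  case (add f h)
  then show ?case by (simp add: laurent_deriv_add distrib_right)
qed

lemma laurent_scale_mult: "laurent_scale c f * g = laurent_scale c (f * g)" "f * laurent_scale c g = laurent_scale c (f * g)"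
  by (simp_all add: laurent_scale_conv_mult mult_ac)

lemma laurent_scale_diff: "laurent_scale c (f - g) = laurent_scale c f - laurent_scale c g"
  by (simp add: laurent_scale_conv_mult right_diff_distrib)

lemma vector_space_laurent_scale: "vector_space laurent_scale"
  by unfold_locales (auto intro!: poly_mapping_eqI simp: lookup_laurent_scale lookup_add algebra_simps)

lemma vector_space_hv_scale: "vector_space hv_scale"
proof -
  interpret vector_space laurent_scale by (rule vector_space_laurent_scale)
  show ?thesis by unfold_locales (auto simp: algebra_simps)
qed

lemma lie_algebra_hv: "lie_algebra hv_scale UNIV (hv_bracket :: 'k::field hv \<Rightarrow> _)"
proof -
  interpret vector_space "hv_scale :: 'k \<Rightarrow> _" by (rule vector_space_hv_scale)
  have add: "hv_bracket (x + y) z = hv_bracket x z + hv_bracket y z"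
    "hv_bracket z (x + y) = hv_bracket z x + hv_bracket z y" for x y z :: "'k hv"
    by (cases x; cases y; cases z; simp add: laurent_deriv_add algebra_simps)+
  have scl: "hv_bracket (hv_scale c x) y = hv_scale c (hv_bracket x y)"
    "hv_bracket x (hv_scale c y) = hv_scale c (hv_bracket x y)" for c and x y :: "'k hv"
    by (cases x; cases y; simp add: laurent_deriv_scale laurent_scale_mult laurent_scale_diff)+
  have alt: "hv_bracket x x = 0" for x :: "'k hv"
    by (cases x) (simp add: zero_prod_def mult.commute)
  have jac: "hv_bracket x (hv_bracket y z) + hv_bracket y (hv_bracket z x) + hv_bracket z (hv_bracket x y) = 0"
    for x y z :: "'k hv"
    by (cases x; cases y; cases z)
      (simp add: laurent_deriv_diff laurent_deriv_mult algebra_simps zero_prod_def)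
  show ?thesis
    unfolding lie_algebra_def using vector_space_axioms add scl alt jac by simp
qed

lemma hv_bracket_mon:
  "hv_bracket (hv_mon (Inl i)) (hv_mon (Inl j)) = hv_scale (of_int (j - i)) (hv_mon (Inl (i + j - 1)))"
  "hv_bracket (hv_mon (Inl i)) (hv_mon (Inr j)) = hv_scale (of_int j) (hv_mon (Inr (i + j - 1)))"
  "hv_bracket (hv_mon (Inr i)) (hv_mon (Inl j)) = hv_scale (of_int (- i)) (hv_mon (Inr (i + j - 1)))"
  "hv_bracket (hv_mon (Inr i)) (hv_mon (Inr j)) = 0"
  by (simp_all add: laurent_deriv_single laurent_deriv_zero mult_single laurent_scale_single
      laurent_scale_zero algebra_simps zero_prod_def flip: single_diff single_uminus)

text \<open>For \<open>r = a \<otimes> b - b \<otimes> a\<close>, this is \<open>[a, b] = m b\<close>.\<close>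

lemma hv_r_bracket:
  fixes q :: "'k::field"
  shows "hv_bracket (xpow 1, 0) (xpow (m + 1), laurent_scale q (xpow m))
    = hv_scale (of_int m) (xpow (m + 1), laurent_scale q (xpow m))"
  by (simp add: laurent_deriv_single laurent_deriv_zero mult_single laurent_scale_single
      laurent_deriv_scale algebra_simps flip: single_diff)

lemma coboundary_triangular_hv: "coboundary_triangular hv_scale hv_bracket (hv_r m q)"
  unfolding coboundary_triangular_def hv_r_def
  using lie_bialgebra_wedge[OF lie_algebra_hv hv_r_bracket] cybe_wedge[OF vector_space_hv_scale, of hv_bracket, OF hv_r_bracket]
  by blast


section \<open>Functionals and their formal expansions\<close>

text \<open>Linear functionals on the whole Heisenberg-Virasoro algebra.\<close>

abbreviation hv_form :: "('k::field hv \<Rightarrow> 'k) \<Rightarrow> bool" where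
  "hv_form \<equiv> linear_form hv_scale UNIV"

lemma vector_space_field: "vector_space ((*) :: 'k::field \<Rightarrow> 'k \<Rightarrow> 'k)"
  by unfold_locales (auto simp: algebra_simps)

lemma hv_dual_iff: "f \<in> hv_dual \<longleftrightarrow> hv_form f"
  by (auto simp: hv_dual_def Vector_Spaces.linear_iff linear_form_def vector_space_hv_scale
    vector_space_field)

lemma laurent_linear_iff: "Vector_Spaces.linear laurent_scale (*) f \<longleftrightarrow> linear_form laurent_scale UNIV f"
  by (auto simp: Vector_Spaces.linear_iff linear_form_def vector_space_laurent_scale
    vector_space_field)

text \<open>The indices of the monomials that occur in an element.\<close>

definition hv_support :: "'k::field hv \<Rightarrow> (int + int) set" where
  "hv_support z = Inl ` Poly_Mapping.keys (fst z) \<union> Inr ` Poly_Mapping.keys (snd z)"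

lemma finite_hv_support: "finite (hv_support z)"
  by (simp add: hv_support_def)

lemma eps1_pair: "eps1 i (f, g) = Poly_Mapping.lookup f i"
  by (simp add: eps1_def pair_dual_def eps_def)

lemma eps2_pair: "eps2 i (f, g) = Poly_Mapping.lookup g i"
  by (simp add: eps2_def pair_dual_def eps_def)

lemma hv_eps_outside_support: "a \<notin> hv_support z \<Longrightarrow> hv_eps a z = 0"
  by (cases a; cases z) (auto simp: hv_support_def eps1_pair eps2_pair in_keys_iff)

lemma hv_form_eps: "hv_form (hv_eps a)"
  by (cases a) (auto simp: linear_form_def eps1_pair eps2_pair lookup_add lookup_laurent_scale)

lemma hv_form_zero: "hv_form f \<Longrightarrow> f 0 = 0"
  using linear_form_zero[OF lie_algebraD(1,2)[OF lie_algebra_hv]] .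

lemma hv_expand:
  fixes z :: "'k::field hv"
  assumes f: "hv_form f" and S: "finite S" "hv_support z \<subseteq> S"
  shows "f z = (\<Sum>a\<in>S. f (hv_mon a) * hv_eps a z)"
proof -
  have sum: "f (\<Sum>a\<in>A. F a) = (\<Sum>a\<in>A. f (F a))" for A and F :: "int + int \<Rightarrow> 'k hv"
    by (induction A rule: infinite_finite_induct) (simp_all add: hv_form_zero[OF f] linear_formD(1)[OF f])
  have z: "z = (\<Sum>a\<in>hv_support z. hv_scale (hv_eps a z) (hv_mon a))"
  proof -
    obtain p q where [simp]: "z = (p, q)" by (cases z)
    have "(\<Sum>a\<in>hv_support z. hv_scale (hv_eps a z) (hv_mon a))
      = (\<Sum>n\<in>Poly_Mapping.keys p. (Poly_Mapping.single n (Poly_Mapping.lookup p n), 0))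
      + (\<Sum>n\<in>Poly_Mapping.keys q. (0, Poly_Mapping.single n (Poly_Mapping.lookup q n)))"
      unfolding hv_support_def
      by (subst sum.union_disjoint)
        (auto simp: sum.reindex eps1_pair eps2_pair laurent_scale_single laurent_scale_zero)
    also have "\<dots> = (\<Sum>n\<in>Poly_Mapping.keys p. Poly_Mapping.single n (Poly_Mapping.lookup p n),
        \<Sum>n\<in>Poly_Mapping.keys q. Poly_Mapping.single n (Poly_Mapping.lookup q n))"
      by (simp add: prod_eq_iff fst_sum snd_sum)
    also have "\<dots> = z" by (simp flip: laurent_sum_singles)
    finally show ?thesis by simp
  qed
  have "f z = (\<Sum>a\<in>hv_support z. f (hv_mon a) * hv_eps a z)"
    by (subst z) (simp add: sum linear_formD(2)[OF f] mult.commute)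
  also have "\<dots> = (\<Sum>a\<in>S. f (hv_mon a) * hv_eps a z)"
    by (rule sum.mono_neutral_left) (use S in \<open>auto simp: hv_eps_outside_support\<close>)
  finally show ?thesis .
qed

lemma hv_form_eqI:
  assumes "hv_form f" "hv_form g" "\<And>a. f (hv_mon a) = g (hv_mon a)"
  shows "f = g"
proof
  fix z
  show "f z = g z"
    unfolding hv_expand[OF assms(1) finite_hv_support subset_refl, of z]
      hv_expand[OF assms(2) finite_hv_support subset_refl, of z] assms(3) ..
qed

lemma hv_bilinear_eqI:
  fixes B B' :: "'k::field hv \<Rightarrow> 'k hv \<Rightarrow> 'k"
  assumes B: "bilinear_form hv_scale UNIV B" and B': "bilinear_form hv_scale UNIV B'"
    and eq: "\<And>a b. B (hv_mon a) (hv_mon b) = B' (hv_mon a) (hv_mon b)"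
  shows "B = B'"
proof -
  have "B (hv_mon a) = B' (hv_mon a)" for a
    by (rule hv_form_eqI) (auto intro: bilinear_formD[OF B] bilinear_formD[OF B'] eq)
  then have "(\<lambda>\<xi>. B \<xi> \<eta>) = (\<lambda>\<xi>. B' \<xi> \<eta>)" for \<eta>
    by (intro hv_form_eqI) (auto intro: bilinear_formD[OF B] bilinear_formD[OF B'])
  then show ?thesis by (intro ext) (rule fun_cong)
qed

lemma bilinear_form_bracket_dual:
  assumes "hv_form f"
  shows "bilinear_form hv_scale UNIV (bracket_dual f)"
  by (simp add: bilinear_form_def linear_form_def bracket_dual_def
    lie_algebraD(4-7)[OF lie_algebra_hv] linear_formD[OF assms])

lemma bracket_dual_mon:
  assumes f: "hv_form f"
  shows "bracket_dual f (hv_mon (Inl i)) (hv_mon (Inl j)) = of_int (j - i) * f (hv_mon (Inl (i + j - 1)))"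
    "bracket_dual f (hv_mon (Inl i)) (hv_mon (Inr j)) = of_int j * f (hv_mon (Inr (i + j - 1)))"
    "bracket_dual f (hv_mon (Inr i)) (hv_mon (Inl j)) = - of_int i * f (hv_mon (Inr (i + j - 1)))"
    "bracket_dual f (hv_mon (Inr i)) (hv_mon (Inr j)) = 0"
  unfolding bracket_dual_def hv_bracket_mon linear_formD(2)[OF f UNIV_I]
  by (simp_all add: hv_form_zero[OF f])

section \<open>The maximal good subspace\<close>

declare hv_mon.simps [simp del]

text \<open>The functional that is the formal sum of all \<open>c a\<close> times \<open>hv_eps a\<close>.\<close>

definition hv_functional :: "(int + int \<Rightarrow> 'k::field) \<Rightarrow> 'k hv \<Rightarrow> 'k" where
  "hv_functional c z = (\<Sum>a\<in>hv_support z. c a * hv_eps a z)"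

lemma hv_functional_superset:
  assumes "finite S" "hv_support z \<subseteq> S"
  shows "hv_functional c z = (\<Sum>a\<in>S. c a * hv_eps a z)"
  unfolding hv_functional_def
  by (rule sum.mono_neutral_left) (use assms in \<open>auto simp: hv_eps_outside_support\<close>)

lemma hv_form_functional: "hv_form (hv_functional c)"
  unfolding linear_form_def
proof (intro conjI ballI allI)
  fix x y :: "'a hv" and k
  let ?S = "hv_support x \<union> hv_support y \<union> hv_support (x + y) \<union> hv_support (hv_scale k x)"
  have S: "finite ?S" by (simp add: finite_hv_support)
  have e: "hv_functional c z = (\<Sum>a\<in>?S. c a * hv_eps a z)"
    if "z \<in> {x, y, x + y, hv_scale k x}" for z
    by (rule hv_functional_superset[OF S]) (use that in auto)
  show "hv_functional c (x + y) = hv_functional c x + hv_functional c y"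
    by (simp add: e linear_formD(1)[OF hv_form_eps] algebra_simps sum.distrib)
  show "hv_functional c (hv_scale k x) = k * hv_functional c x"
    by (simp add: e linear_formD(2)[OF hv_form_eps] sum_distrib_left mult_ac)
qed

lemma hv_eps_mon: "hv_eps a (hv_mon b) = (if a = b then 1 else 0)"
  by (cases a; cases b) (auto simp: hv_mon.simps eps1_pair eps2_pair lookup_single when_def)

lemma hv_functional_mon:
  fixes c :: "int + int \<Rightarrow> 'k::field"
  shows "hv_functional c (hv_mon a) = c a"
proof -
  let ?S = "insert a (hv_support (hv_mon a :: 'k hv))"
  have "hv_functional c (hv_mon a) = (\<Sum>b\<in>?S. c b * hv_eps b (hv_mon a))"
    by (rule hv_functional_superset) (auto simp: finite_hv_support)
  also have "\<dots> = (\<Sum>b\<in>?S. if b = a then c a else 0)"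
    by (intro sum.cong) (auto simp: hv_eps_mon)
  finally show ?thesis by (simp add: finite_hv_support)
qed

text \<open>
  The functionals with both coefficient sequences linearly recurrent, expressed by finite Hankel
  rank; this set turns out to be the maximal good subspace.
\<close>

definition hv_recurrent :: "('k::field hv \<Rightarrow> 'k) set" where
  "hv_recurrent = {f. hv_form f \<and> hankel_finite (\<lambda>n. f (hv_mon (Inl n))) \<and> hankel_finite (\<lambda>n. f (hv_mon (Inr n)))}"

lemma laurent_circ_iff:
  "f \<in> laurent_circ \<longleftrightarrow> linear_form laurent_scale UNIV f \<and> hankel_finite (\<lambda>n. f (xpow n))"
  unfolding laurent_circ_def laurent_linear_iff linear_recurrent_iff_hankel_finite[symmetric]
    linear_recurrent_def mem_Collect_eq ..

lemma hv_recurrent_eq: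
  "(hv_recurrent :: ('k::field hv \<Rightarrow> 'k) set) = {pair_dual f g |f g. f \<in> laurent_circ \<and> g \<in> laurent_circ}"
proof (intro equalityI subsetI)
  fix f :: "'k hv \<Rightarrow> 'k"
  assume "f \<in> hv_recurrent"
  then have f: "hv_form f" "hankel_finite (\<lambda>n. f (xpow n, 0))" "hankel_finite (\<lambda>n. f (0, xpow n))"
    unfolding hv_recurrent_def hv_mon.simps by blast+
  let ?g = "\<lambda>p. f (p, 0)" and ?h = "\<lambda>p. f (0, p)"
  have "f z = pair_dual ?g ?h z" for z
    using linear_formD(1)[OF f(1), of "(fst z, 0)" "(0, snd z)"] by (simp add: pair_dual_def split_def)
  then have "f = pair_dual ?g ?h" ..
  moreover have "linear_form laurent_scale UNIV ?g"
    unfolding linear_form_def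
  proof (intro conjI ballI allI)
    show "f (p + p', 0) = f (p, 0) + f (p', 0)" for p p'
      using linear_formD(1)[OF f(1), of "(p, 0)" "(p', 0)"] by simp
    show "f (laurent_scale c p, 0) = c * f (p, 0)" for c p
      using linear_formD(2)[OF f(1), of "(p, 0)" c] by (simp add: laurent_scale_zero)
  qed
  moreover have "linear_form laurent_scale UNIV ?h"
    unfolding linear_form_def
  proof (intro conjI ballI allI)
    show "f (0, p + p') = f (0, p) + f (0, p')" for p p'
      using linear_formD(1)[OF f(1), of "(0, p)" "(0, p')"] by simp
    show "f (0, laurent_scale c p) = c * f (0, p)" for c p
      using linear_formD(2)[OF f(1), of "(0, p)" c] by (simp add: laurent_scale_zero)
  qed
  ultimately show "f \<in> {pair_dual f g |f g. f \<in> laurent_circ \<and> g \<in> laurent_circ}"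
    using f(2,3) unfolding laurent_circ_iff by blast
next
  fix f :: "'k hv \<Rightarrow> 'k"
  assume "f \<in> {pair_dual f g |f g. f \<in> laurent_circ \<and> g \<in> laurent_circ}"
  then obtain g h where f: "f = pair_dual g h"
    and g: "linear_form laurent_scale UNIV g" "hankel_finite (\<lambda>n. g (xpow n))"
    and h: "linear_form laurent_scale UNIV h" "hankel_finite (\<lambda>n. h (xpow n))"
    by (auto simp: laurent_circ_iff)
  have zero: "g 0 = 0" "h 0 = 0"
    using linear_formD(2)[OF g(1), of 0 0] linear_formD(2)[OF h(1), of 0 0] by (simp_all add: laurent_scale_zero)
  have "hv_form f"
    by (auto simp: f linear_form_def pair_dual_def linear_formD[OF g(1)] linear_formD[OF h(1)] algebra_simps)
  then show "f \<in> hv_recurrent"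
    using g(2) h(2) by (simp add: hv_recurrent_def f pair_dual_def hv_mon.simps zero)
qed

lemma subspace_hv_recurrent: "module.subspace dual_scale hv_recurrent"
  unfolding subspace_dual_scale_iff hv_recurrent_def
  using hankel_finite_add hankel_finite_scale
  by (auto simp: hankel_finite_zero linear_form_add linear_form_mult)
    (simp add: linear_form_def)

lemma hv_functional_in_recurrent:
  "hankel_finite F \<Longrightarrow> hankel_finite G \<Longrightarrow> hv_functional (case_sum F G) \<in> hv_recurrent"
  by (simp add: hv_recurrent_def hv_form_functional hv_functional_mon)

text \<open>
  The bracket multiplies a splitting \<open>F (i + j)\<close> by \<open>j - i\<close>, respectively by \<open>j\<close>, and multiplication
  by the index preserves finite Hankel rank.
\<close>

lemma hv_recurrent_tensor:
  assumes f: "f \<in> hv_recurrent"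
  shows "\<exists>r. set r \<subseteq> hv_recurrent \<times> hv_recurrent \<and> (\<forall>\<xi> \<eta>. bracket_dual f \<xi> \<eta> = (\<Sum>(g, h)\<leftarrow>r. g \<xi> * h \<eta>))"
proof -
  have form: "hv_form f" and hank: "hankel_finite (\<lambda>n. f (hv_mon (Inl n)))" "hankel_finite (\<lambda>n. f (hv_mon (Inr n)))"
    using f by (auto simp: hv_recurrent_def)
  obtain ps where ps: "\<forall>(g, h)\<in>set ps. hankel_finite g \<and> hankel_finite h"
    "\<And>i j. f (hv_mon (Inl (i + j + - 1))) = (\<Sum>(g, h)\<leftarrow>ps. g i * h j)"
    using hankel_finite_split[OF hankel_finite_shift[OF hank(1), of "- 1"]] by auto
  obtain qs where qs: "\<forall>(g, h)\<in>set qs. hankel_finite g \<and> hankel_finite h"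
    "\<And>i j. f (hv_mon (Inr (i + j + - 1))) = (\<Sum>(g, h)\<leftarrow>qs. g i * h j)"
    using hankel_finite_split[OF hankel_finite_shift[OF hank(2), of "- 1"]] by auto
  define U V :: "(int \<Rightarrow> 'a) \<Rightarrow> 'a hv \<Rightarrow> 'a"
    where "U = (\<lambda>g. hv_functional (case_sum g (\<lambda>_. 0)))" and "V = (\<lambda>g. hv_functional (case_sum (\<lambda>_. 0) g))"
  define N :: "(int \<Rightarrow> 'a) \<Rightarrow> int \<Rightarrow> 'a" where "N = (\<lambda>g n. of_int n * g n)"
  define M :: "(int \<Rightarrow> 'a) \<Rightarrow> int \<Rightarrow> 'a" where "M = (\<lambda>g n. - 1 * (of_int n * g n))"
  have UV: "U g \<in> hv_recurrent" "V g \<in> hv_recurrent" "hankel_finite (N g)" "hankel_finite (M g)"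
    if "hankel_finite g" for g
    unfolding U_def V_def N_def M_def
    by (intro that hankel_finite_zero hv_functional_in_recurrent hankel_finite_of_int_mult hankel_finite_scale)+
  have mon: "U g (hv_mon (Inl i)) = g i" "U g (hv_mon (Inr i)) = 0"
    "V g (hv_mon (Inl i)) = 0" "V g (hv_mon (Inr i)) = g i" for g i
    by (simp_all add: U_def V_def hv_functional_mon)
  define r where "r = map (\<lambda>(g, h). (U g, U (N h))) ps @ map (\<lambda>(g, h). (U (M g), U h)) ps
    @ map (\<lambda>(g, h). (U g, V (N h))) qs @ map (\<lambda>(g, h). (V (M g), U h)) qs"
  have r: "set r \<subseteq> hv_recurrent \<times> hv_recurrent"
    using ps(1) qs(1) by (auto simp: r_def UV)
  have "bilinear_form hv_scale UNIV (\<lambda>\<xi> \<eta>. \<Sum>(g, h)\<leftarrow>r. g \<xi> * h \<eta>)"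
    unfolding bilinear_form_def split_def
    using r by (auto intro!: linear_form_sum_list linear_form_mult simp: hv_recurrent_def)
  then have "bracket_dual f = (\<lambda>\<xi> \<eta>. \<Sum>(g, h)\<leftarrow>r. g \<xi> * h \<eta>)"
  proof (rule hv_bilinear_eqI[OF bilinear_form_bracket_dual[OF form]])
    fix a b
    show "bracket_dual f (hv_mon a) (hv_mon b) = (\<Sum>(g, h)\<leftarrow>r. g (hv_mon a) * h (hv_mon b))"
    proof (cases a; cases b)
      fix i j assume [simp]: "a = Inl i" "b = Inl j"
      show ?thesis
        unfolding r_def
        by (simp add: bracket_dual_mon[OF form] ps(2)[simplified] comp_def split_def mon N_def M_def
            left_diff_distrib mult_ac sum_list_const_mult sum_list_minus)
    next
      fix i j assume [simp]: "a = Inl i" "b = Inr j"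
      show ?thesis
        unfolding r_def
        by (simp add: bracket_dual_mon[OF form] qs(2)[simplified] comp_def split_def mon N_def M_def
            mult_ac sum_list_const_mult)
    next
      fix i j assume [simp]: "a = Inr i" "b = Inl j"
      show ?thesis
        unfolding r_def
        by (simp add: bracket_dual_mon[OF form] qs(2)[simplified] comp_def split_def mon N_def M_def
            mult_ac sum_list_const_mult sum_list_minus)
    next
      fix i j assume [simp]: "a = Inr i" "b = Inr j"
      show ?thesis
        unfolding r_def
        by (simp add: bracket_dual_mon[OF form] comp_def split_def mon)
    qed
  qed
  then show ?thesis using r by (intro exI[of _ r]) simp
qed

lemma good_subspace_hv_recurrent: "good_subspace hv_recurrent"
  unfolding good_subspace_def
proof (intro conjI ballI subspace_hv_recurrent)
  show "hv_recurrent \<subseteq> hv_dual" by (auto simp: hv_recurrent_def hv_dual_iff)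
  fix f :: "'a hv \<Rightarrow> 'a" assume "f \<in> hv_recurrent"
  from hv_recurrent_tensor[OF this] obtain r where r: "set r \<subseteq> hv_recurrent \<times> hv_recurrent"
    "\<And>\<xi> \<eta>. bracket_dual f \<xi> \<eta> = (\<Sum>(g, h)\<leftarrow>r. g \<xi> * h \<eta>)" by blast
  have "eval_tensor (tensor_of dual_scale hv_recurrent r) = bracket_dual f"
    by (intro ext) (simp add: eval_tensor_def tensor_of_bilinear[OF bilinear_form_evals] r(2))
  then show "\<exists>t\<in>tensor_square dual_scale hv_recurrent. eval_tensor t = bracket_dual f"
    using r(1) unfolding tensor_square_def by blast
qed

text \<open>
  Conversely, let the bilinear form \<open>f [\<xi>, \<eta>]\<close> have finite rank.  On monomials it is
  \<open>(j - i) F (i + j - 1)\<close>, and replacing \<open>(i, j)\<close> by \<open>(i + 1, j - 1)\<close> lowers the factor by 2, so the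
  difference shows that \<open>F\<close> itself has finite Hankel rank.  For the second summand the factor is
  \<open>j\<close> and the difference is \<open>F\<close>.
\<close>

lemma hankel_finite_of_finite_rank:
  fixes F :: "int \<Rightarrow> 'k::field"
  assumes "c \<noteq> 0" and F: "\<And>i j. B i j - B (i + 1) (j - 1) = c * F (i + j - 1)"
    and B: "\<And>i j. B i j = (\<Sum>(g, h)\<leftarrow>r. u g i * v h j)"
  shows "hankel_finite F"
proof -
  let ?ps = "map (\<lambda>(g, h). (\<lambda>i. inverse c * u g i, \<lambda>j. v h (j + 1))) r
    @ map (\<lambda>(g, h). (\<lambda>i. - inverse c * u g (i + 1), \<lambda>j. v h j)) r"
  have "F (i + j) = (\<Sum>(g, h)\<leftarrow>?ps. g i * h j)" for i j
  proof -
    have "F (i + j) = inverse c * (B i (j + 1) - B (i + 1) j)"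
      using F[of i "j + 1"] assms(1) by simp
    also have "\<dots> = (\<Sum>(g, h)\<leftarrow>?ps. g i * h j)"
      unfolding B by (induction r) (auto simp: algebra_simps)
    finally show ?thesis .
  qed
  then show ?thesis unfolding hankel_finite_def by blast
qed

lemma good_subspace_recurrent:
  fixes U :: "('k::field_char_0 hv \<Rightarrow> 'k) set"
  assumes "good_subspace U"
  shows "U \<subseteq> hv_recurrent"
proof
  fix f assume f: "f \<in> U"
  have form: "hv_form f"
    using assms f unfolding good_subspace_def hv_dual_iff[symmetric] by blast
  obtain t where t: "t \<in> tensor_square dual_scale U" "eval_tensor t = bracket_dual f"
    using assms f unfolding good_subspace_def by blast
  obtain r where r: "t = tensor_of dual_scale U r"
    using t(1) unfolding tensor_square_def by blast
  have B: "bracket_dual f \<xi> \<eta> = (\<Sum>(g, h)\<leftarrow>r. g \<xi> * h \<eta>)" for \<xi> \<eta>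
    using fun_cong[OF fun_cong[OF t(2)], of \<xi> \<eta>]
    unfolding r eval_tensor_def tensor_of_bilinear[OF bilinear_form_evals] by (rule sym)
  have "hankel_finite (\<lambda>n. f (hv_mon (Inl n)))"
  proof (rule hankel_finite_of_finite_rank[where B = "\<lambda>i j. bracket_dual f (hv_mon (Inl i)) (hv_mon (Inl j))"
      and u = "\<lambda>g i. g (hv_mon (Inl i))" and v = "\<lambda>g j. g (hv_mon (Inl j))" and r = r and c = 2])
    show "bracket_dual f (hv_mon (Inl i)) (hv_mon (Inl j))
      - bracket_dual f (hv_mon (Inl (i + 1))) (hv_mon (Inl (j - 1))) = 2 * f (hv_mon (Inl (i + j - 1)))" for i j
      unfolding bracket_dual_mon[OF form] by (simp add: algebra_simps)
  qed (simp_all only: B, simp)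
  moreover have "hankel_finite (\<lambda>n. f (hv_mon (Inr n)))"
  proof (rule hankel_finite_of_finite_rank[where B = "\<lambda>i j. bracket_dual f (hv_mon (Inl i)) (hv_mon (Inr j))"
      and u = "\<lambda>g i. g (hv_mon (Inl i))" and v = "\<lambda>g j. g (hv_mon (Inr j))" and r = r and c = 1])
    show "bracket_dual f (hv_mon (Inl i)) (hv_mon (Inr j))
      - bracket_dual f (hv_mon (Inl (i + 1))) (hv_mon (Inr (j - 1))) = 1 * f (hv_mon (Inr (i + j - 1)))" for i j
      unfolding bracket_dual_mon[OF form] by (simp add: algebra_simps)
  qed (simp_all only: B, simp)
  ultimately show "f \<in> hv_recurrent" using form by (simp add: hv_recurrent_def)
qed

lemma hv_circ_eq_recurrent: "(hv_circ :: ('k::field_char_0 hv \<Rightarrow> 'k) set) = hv_recurrent"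
proof
  have "\<Union>{U. good_subspace U} \<subseteq> (hv_recurrent :: ('k hv \<Rightarrow> 'k) set)"
    by (rule Union_least) (simp add: good_subspace_recurrent)
  then show "(hv_circ :: ('k hv \<Rightarrow> 'k) set) \<subseteq> hv_recurrent"
    unfolding hv_circ_def by (rule module.span_minimal[OF module_dual_scale _ subspace_hv_recurrent])
  show "hv_recurrent \<subseteq> (hv_circ :: ('k hv \<Rightarrow> 'k) set)"
  proof
    fix f :: "'k hv \<Rightarrow> 'k" assume "f \<in> hv_recurrent"
    then have "f \<in> \<Union>{U. good_subspace U}" using good_subspace_hv_recurrent by blast
    then show "f \<in> hv_circ" unfolding hv_circ_def by (rule module.span_base[OF module_dual_scale])
  qed
qed

section \<open>Formulas for the dual maps\<close>

lemma termwise_sumI: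
  assumes "finite J" "J \<subseteq> I" "\<And>i. i \<in> I \<Longrightarrow> i \<notin> J \<Longrightarrow> F i = 0" "v = sum F J"
  shows "termwise_sum F I v"
proof -
  have "{i \<in> I. F i \<noteq> 0} \<subseteq> J" using assms(3) by auto
  moreover have "sum F {i \<in> I. F i \<noteq> 0} = sum F J"
    by (rule sum.mono_neutral_left) (use assms in auto)
  ultimately show ?thesis
    using assms(1,4) by (auto simp: termwise_sum_def intro: finite_subset)
qed

lemma lookup_single_mult:
  fixes g :: "'k::field laurent"
  shows "Poly_Mapping.lookup (Poly_Mapping.single n c * g) p = c * Poly_Mapping.lookup g (p - n)"
proof (induction g rule: laurent_induct)
  case (single k d)
  show ?case by (auto simp: mult_single lookup_single when_def)
next
  case (add g h)
  then show ?case by (simp add: distrib_left lookup_add)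
qed

lemma lookup_mult_single:
  fixes g :: "'k::field laurent"
  shows "Poly_Mapping.lookup (g * Poly_Mapping.single n c) p = c * Poly_Mapping.lookup g (p - n)"
  using lookup_single_mult[of n c g p] by (simp add: mult.commute)

lemma lookup_laurent_mult:
  fixes f g :: "'k::field laurent"
  assumes "finite A" "Poly_Mapping.keys f \<subseteq> A"
  shows "Poly_Mapping.lookup (f * g) p = (\<Sum>i\<in>A. Poly_Mapping.lookup f i * Poly_Mapping.lookup g (p - i))"
proof -
  have "Poly_Mapping.lookup (f * g) p
    = (\<Sum>i\<in>Poly_Mapping.keys f. Poly_Mapping.lookup f i * Poly_Mapping.lookup g (p - i))"
    by (subst laurent_sum_singles[of f]) (simp add: sum_distrib_right lookup_sum lookup_single_mult)
  also have "\<dots> = (\<Sum>i\<in>A. Poly_Mapping.lookup f i * Poly_Mapping.lookup g (p - i))"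
    by (rule sum.mono_neutral_left) (use assms in \<open>auto simp: in_keys_iff\<close>)
  finally show ?thesis .
qed

lemma lookup_laurent_deriv_mult:
  fixes f g :: "'k::field laurent"
  assumes "finite A" "Poly_Mapping.keys f \<subseteq> A"
  shows "Poly_Mapping.lookup (laurent_deriv f * g) p
    = (\<Sum>i\<in>A. of_int i * Poly_Mapping.lookup f i * Poly_Mapping.lookup g (p + 1 - i))"
proof -
  have "Poly_Mapping.lookup (laurent_deriv f * g) p
    = (\<Sum>i\<in>Poly_Mapping.keys f. of_int i * Poly_Mapping.lookup f i * Poly_Mapping.lookup g (p + 1 - i))"
    unfolding laurent_deriv_def sum_distrib_right lookup_sum lookup_single_mult
    by (simp add: algebra_simps)
  also have "\<dots> = (\<Sum>i\<in>A. of_int i * Poly_Mapping.lookup f i * Poly_Mapping.lookup g (p + 1 - i))"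
    by (rule sum.mono_neutral_left) (use assms in \<open>auto simp: in_keys_iff\<close>)
  finally show ?thesis .
qed

lemma bracket_dual_eps1_termwise:
  "termwise_sum (\<lambda>(i, j). of_int (j - i) * (eps1 i \<xi> * eps1 j \<eta>)) {(i, j). i + j = p + 1}
    (bracket_dual (eps1 p :: 'k::field hv \<Rightarrow> 'k) \<xi> \<eta>)"
proof -
  obtain f1 f2 g1 g2 where e: "\<xi> = (f1, f2)" "\<eta> = (g1, g2)" by (cases \<xi>; cases \<eta>)
  let ?A = "Poly_Mapping.keys f1"
  have "bracket_dual (eps1 p) \<xi> \<eta>
    = Poly_Mapping.lookup (f1 * laurent_deriv g1) p - Poly_Mapping.lookup (laurent_deriv f1 * g1) p"
    by (simp add: bracket_dual_def e eps1_pair lookup_minus mult.commute)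
  also have "\<dots> = (\<Sum>i\<in>?A. of_int (p + 1 - i - i) * (eps1 i \<xi> * eps1 (p + 1 - i) \<eta>))"
    unfolding lookup_laurent_deriv_mult[OF finite_keys subset_refl]
    unfolding lookup_laurent_mult[OF finite_keys subset_refl] sum_subtractf[symmetric]
    by (rule sum.cong) (auto simp: e eps1_pair lookup_laurent_deriv algebra_simps)
  also have "\<dots> = (\<Sum>(i, j)\<in>(\<lambda>i. (i, p + 1 - i)) ` ?A. of_int (j - i) * (eps1 i \<xi> * eps1 j \<eta>))"
    by (subst sum.reindex) (auto simp: inj_on_def)
  finally show ?thesis
    by (intro termwise_sumI[of "(\<lambda>i. (i, p + 1 - i)) ` ?A"]) (auto simp: e eps1_pair image_iff in_keys_iff)
qed

lemma bracket_dual_eps2_termwise: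
  "termwise_sum (\<lambda>(i, j). of_int j * (eps1 i \<xi> * eps2 j \<eta>) - of_int i * (eps2 i \<xi> * eps1 j \<eta>))
    {(i, j). i + j = p + 1} (bracket_dual (eps2 p :: 'k::field hv \<Rightarrow> 'k) \<xi> \<eta>)"
proof -
  obtain f1 f2 g1 g2 where e: "\<xi> = (f1, f2)" "\<eta> = (g1, g2)" by (cases \<xi>; cases \<eta>)
  let ?A = "Poly_Mapping.keys f1 \<union> Poly_Mapping.keys f2"
  have A: "finite ?A" "Poly_Mapping.keys f1 \<subseteq> ?A" "Poly_Mapping.keys f2 \<subseteq> ?A" by auto
  have "bracket_dual (eps2 p) \<xi> \<eta>
    = Poly_Mapping.lookup (f1 * laurent_deriv g2) p - Poly_Mapping.lookup (laurent_deriv f2 * g1) p"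
    by (simp add: bracket_dual_def e eps2_pair lookup_minus mult.commute)
  also have "\<dots> = (\<Sum>i\<in>?A. of_int (p + 1 - i) * (eps1 i \<xi> * eps2 (p + 1 - i) \<eta>)
      - of_int i * (eps2 i \<xi> * eps1 (p + 1 - i) \<eta>))"
    unfolding lookup_laurent_deriv_mult[OF A(1,3)]
    unfolding lookup_laurent_mult[OF A(1,2)] sum_subtractf[symmetric]
    by (rule sum.cong) (auto simp: e eps1_pair eps2_pair lookup_laurent_deriv algebra_simps)
  also have "\<dots> = (\<Sum>(i, j)\<in>(\<lambda>i. (i, p + 1 - i)) ` ?A.
      of_int j * (eps1 i \<xi> * eps2 j \<eta>) - of_int i * (eps2 i \<xi> * eps1 j \<eta>))"
    by (subst sum.reindex) (auto simp: inj_on_def)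
  finally show ?thesis
    by (intro termwise_sumI[of "(\<lambda>i. (i, p + 1 - i)) ` ?A"])
      (auto simp: e eps1_pair eps2_pair image_iff in_keys_iff)
qed

lemma bracket_dual_termwise:
  assumes "hv_form f"
  shows "termwise_sum (\<lambda>a. f (hv_mon a) * bracket_dual (hv_eps a) \<xi> \<eta>) UNIV (bracket_dual f \<xi> \<eta>)"
  unfolding bracket_dual_def
  by (rule termwise_sumI[OF finite_hv_support subset_UNIV])
    (auto simp: hv_eps_outside_support intro: hv_expand[OF assms finite_hv_support subset_refl])

text \<open>A tensor has finitely many monomials in its factors, so only finitely many terms are nonzero.\<close>

lemma tensor_form_termwise:
  fixes r :: "('k::field hv \<times> 'k hv) list"
  assumes f: "hv_form f" and h: "hv_form h"
  shows "termwise_sum (\<lambda>(a, b). f (hv_mon a) * h (hv_mon b) * (\<Sum>(u, v)\<leftarrow>r. hv_eps a u * hv_eps b v)) UNIV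
    (\<Sum>(u, v)\<leftarrow>r. f u * h v)"
proof -
  define S where "S = (\<Union>(u, v)\<in>set r. hv_support u \<union> hv_support v)"
  have S: "finite S" by (auto simp: S_def finite_hv_support)
  have sup: "hv_support u \<subseteq> S" "hv_support v \<subseteq> S" if "(u, v) \<in> set r" for u v
    using that by (auto simp: S_def)
  have zero: "(\<Sum>(u, v)\<leftarrow>r. hv_eps a u * hv_eps b v) = 0" if "a \<notin> S \<or> b \<notin> S" for a b
  proof -
    have "(\<Sum>(u, v)\<leftarrow>r. hv_eps a u * hv_eps b v) = (\<Sum>_\<leftarrow>r. 0)"
    proof (rule sum_list_cong, clarify)
      fix u v assume "(u, v) \<in> set r"
      from sup[OF this] have "a \<notin> hv_support u \<or> b \<notin> hv_support v" using that by blast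
      then show "hv_eps a u * hv_eps b v = 0" using hv_eps_outside_support by fastforce
    qed
    then show ?thesis by simp
  qed
  have "(\<Sum>(u, v)\<leftarrow>r. f u * h v) = (\<Sum>(u, v)\<leftarrow>r. \<Sum>(a, b)\<in>S \<times> S. f (hv_mon a) * h (hv_mon b) * (hv_eps a u * hv_eps b v))"
  proof (rule sum_list_cong, clarify)
    fix u v assume uv: "(u, v) \<in> set r"
    show "f u * h v = (\<Sum>(a, b)\<in>S \<times> S. f (hv_mon a) * h (hv_mon b) * (hv_eps a u * hv_eps b v))"
      unfolding hv_expand[OF f S sup(1)[OF uv]] hv_expand[OF h S sup(2)[OF uv]] sum_product sum.cartesian_product
      by (simp add: mult_ac)
  qed
  also have "\<dots> = (\<Sum>(a, b)\<in>S \<times> S. f (hv_mon a) * h (hv_mon b) * (\<Sum>(u, v)\<leftarrow>r. hv_eps a u * hv_eps b v))"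
    by (induction r) (auto simp: algebra_simps sum.distrib split_def)
  finally have total: "(\<Sum>(u, v)\<leftarrow>r. f u * h v)
    = (\<Sum>(a, b)\<in>S \<times> S. f (hv_mon a) * h (hv_mon b) * (\<Sum>(u, v)\<leftarrow>r. hv_eps a u * hv_eps b v))" .
  show ?thesis
  proof (rule termwise_sumI[OF finite_cartesian_product[OF S S] subset_UNIV _ total])
    fix ab assume "ab \<notin> S \<times> S"
    then show "(case ab of (a, b) \<Rightarrow> f (hv_mon a) * h (hv_mon b) * (\<Sum>(u, v)\<leftarrow>r. hv_eps a u * hv_eps b v)) = 0"
      using zero[of "fst ab" "snd ab"] by (simp add: split_def mem_Times_iff)
  qed
qed

lemma cobracket_dual_termwise:
  assumes "hv_form f" "hv_form h"
  shows "termwise_sum (\<lambda>(a, b). f (hv_mon a) * h (hv_mon b) *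
      cobracket_dual (coboundary hv_scale hv_bracket r) (hv_eps a) (hv_eps b) \<xi>) UNIV
    (cobracket_dual (coboundary hv_scale hv_bracket r) f h \<xi>)"
proof -
  obtain d where d: "coboundary hv_scale hv_bracket r \<xi> = tensor_of hv_scale UNIV d"
    using coboundary_in_tensor_square[OF lie_algebra_hv, of r \<xi>] by (auto simp: tensor_square_def)
  have list: "cobracket_dual (coboundary hv_scale hv_bracket r) f h \<xi> = (\<Sum>(u, v)\<leftarrow>d. f u * h v)"
    if "hv_form f" "hv_form h" for f h
    unfolding cobracket_dual_def pair_tensor_def d by (rule tensor_of_bilinear[OF bilinear_form_mult[OF that]])
  show ?thesis
    unfolding list[OF assms] list[OF hv_form_eps hv_form_eps] by (rule tensor_form_termwise[OF assms])
qed

lemma cobracket_dual_hv_r: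
  fixes m :: int and q :: "'k::field"
  assumes "hv_form f" "hv_form h"
  defines "a \<equiv> (xpow 1, 0)" and "b \<equiv> (xpow (m + 1), laurent_scale q (xpow m))"
  shows "cobracket_dual (coboundary hv_scale hv_bracket (hv_r m q)) f h \<xi> =
    f (hv_bracket \<xi> a) * h b + f a * h (hv_bracket \<xi> b) - f (hv_bracket \<xi> b) * h a - f b * h (hv_bracket \<xi> a)"
  unfolding cobracket_dual_def pair_tensor_def hv_r_def a_def b_def
  by (rule coboundary_wedge[OF lie_algebra_hv bilinear_form_mult[OF assms(1,2)]])

text \<open>The functional \<open>f [\<cdot>, \<eta>]\<close> is a combination of the first factors of a tensor over the subspace.\<close>

lemma hv_recurrent_bracket:
  assumes "f \<in> hv_recurrent"
  shows "(\<lambda>\<xi>. f (hv_bracket \<xi> \<eta>)) \<in> hv_recurrent"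
proof -
  obtain r where r: "set r \<subseteq> hv_recurrent \<times> hv_recurrent"
    "\<And>\<xi> \<eta>. bracket_dual f \<xi> \<eta> = (\<Sum>(g, h)\<leftarrow>r. g \<xi> * h \<eta>)"
    using hv_recurrent_tensor[OF assms] by blast
  have "(\<lambda>\<xi>. \<Sum>gh\<leftarrow>r. snd gh \<eta> * fst gh \<xi>) \<in> hv_recurrent"
    by (rule subspace_sum_list[OF subspace_hv_recurrent])
      (use r(1) in \<open>auto intro!: subspace_dual_scaleD(3)[OF subspace_hv_recurrent]\<close>)
  then show ?thesis using r(2)[of _ \<eta>] by (simp add: bracket_dual_def split_def mult.commute)
qed

lemma cobracket_dual_hv_recurrent:
  assumes "f \<in> hv_recurrent" "h \<in> hv_recurrent"
  shows "cobracket_dual (coboundary hv_scale hv_bracket (hv_r m q)) f h \<in> hv_recurrent"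
proof -
  let ?a = "(xpow 1, 0)" and ?b = "(xpow (m + 1), laurent_scale q (xpow m))"
  have form: "hv_form f" "hv_form h" using assms by (auto simp: hv_recurrent_def)
  have "cobracket_dual (coboundary hv_scale hv_bracket (hv_r m q)) f h = (\<lambda>\<xi>.
      h ?b * f (hv_bracket \<xi> ?a) + f ?a * h (hv_bracket \<xi> ?b)
      - h ?a * f (hv_bracket \<xi> ?b) - f ?b * h (hv_bracket \<xi> ?a))"
    by (rule ext) (simp only: cobracket_dual_hv_r[OF form] mult.commute)
  then show ?thesis
    by (simp only:) (intro subspace_dual_scaleD(2,3,4)[OF subspace_hv_recurrent] hv_recurrent_bracket assms)
qed


section \<open>The table of brackets\<close>

text \<open>
  Evaluation on \<open>r = a \<otimes> b - b \<otimes> a\<close> reduces the table to the values of the coordinate functionals at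
  \<open>a\<close>, \<open>b\<close>, \<open>[\<xi>, a]\<close> and \<open>[\<xi>, b]\<close>.
\<close>

lemma hv_eps_r:
  fixes m :: int and q :: "'k::field"
  defines "a \<equiv> (xpow 1, 0)" and "b \<equiv> (xpow (m + 1), laurent_scale q (xpow m))"
  shows "eps1 n a = (if n = 1 then 1 else 0)" "eps2 n a = 0"
    "eps1 n b = (if n = m + 1 then 1 else 0)" "eps2 n b = (if n = m then q else 0)"
    "eps1 n (hv_bracket \<xi> a) = of_int (1 - n) * eps1 n \<xi>"
    "eps2 n (hv_bracket \<xi> a) = - of_int n * eps2 n \<xi>"
    "eps1 n (hv_bracket \<xi> b) = of_int (2 * m + 1 - n) * eps1 (n - m) \<xi>"
    "eps2 n (hv_bracket \<xi> b) = of_int m * q * eps1 (n - m + 1) \<xi> - of_int (n - m) * eps2 (n - m) \<xi>"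
proof -
  obtain f g where \<xi>: "\<xi> = (f, g)" by (cases \<xi>)
  note simps = a_def b_def \<xi> hv_bracket.simps eps1_pair eps2_pair lookup_minus lookup_single_mult lookup_mult_single
    laurent_scale_single laurent_deriv_single laurent_deriv_zero lookup_laurent_deriv
  show "eps1 n a = (if n = 1 then 1 else 0)" "eps2 n a = 0"
    "eps1 n b = (if n = m + 1 then 1 else 0)" "eps2 n b = (if n = m then q else 0)"
    by (auto simp: simps lookup_single when_def)
  show "eps1 n (hv_bracket \<xi> a) = of_int (1 - n) * eps1 n \<xi>"
    "eps2 n (hv_bracket \<xi> a) = - of_int n * eps2 n \<xi>"
    "eps1 n (hv_bracket \<xi> b) = of_int (2 * m + 1 - n) * eps1 (n - m) \<xi>"
    "eps2 n (hv_bracket \<xi> b) = of_int m * q * eps1 (n - m + 1) \<xi> - of_int (n - m) * eps2 (n - m) \<xi>"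
    unfolding simps by (simp_all add: algebra_simps)
qed

lemma bracket_table_hv:
  fixes m :: int and q :: "'k::field"
  shows "bracket_table m q (\<lambda>a b. cobracket_dual (coboundary hv_scale hv_bracket (hv_r m q)) (hv_eps a) (hv_eps b))"
proof -
  let ?K = "\<lambda>a b. cobracket_dual (coboundary hv_scale hv_bracket (hv_r m q)) (hv_eps a) (hv_eps b)"
  note K = cobracket_dual_hv_r[OF hv_form_eps hv_form_eps, of m q]
  have LL: "?K (Inl i) (Inl j) \<xi> = of_int (1 - i) * eps1 i \<xi> * (if j = m + 1 then 1 else 0)
      + (if i = 1 then 1 else 0) * (of_int (2 * m + 1 - j) * eps1 (j - m) \<xi>)
      - of_int (2 * m + 1 - i) * eps1 (i - m) \<xi> * (if j = 1 then 1 else 0)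
      - (if i = m + 1 then 1 else 0) * (of_int (1 - j) * eps1 j \<xi>)" for i j \<xi>
    unfolding K unfolding hv_eps.simps hv_eps_r ..
  have LR: "?K (Inl i) (Inr j) \<xi> = of_int (1 - i) * eps1 i \<xi> * (if j = m then q else 0)
      + (if i = 1 then 1 else 0) * (of_int m * q * eps1 (j - m + 1) \<xi> - of_int (j - m) * eps2 (j - m) \<xi>)
      - of_int (2 * m + 1 - i) * eps1 (i - m) \<xi> * 0
      - (if i = m + 1 then 1 else 0) * (- of_int j * eps2 j \<xi>)" for i j \<xi>
    unfolding K unfolding hv_eps.simps hv_eps_r ..
  have RR: "?K (Inr i) (Inr j) \<xi> = - of_int i * eps2 i \<xi> * (if j = m then q else 0)
      - (if i = m then q else 0) * (- of_int j * eps2 j \<xi>)" for i j \<xi>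
    unfolding K unfolding hv_eps.simps hv_eps_r by simp
  show ?thesis
    unfolding bracket_table_def
  proof (intro conjI allI impI)
    fix i j
    show "?K (Inl i) (Inl j) = (\<lambda>\<xi>. of_int (2 * m - j + 1) * eps1 (j - m) \<xi>)"
      if "m \<noteq> 0 \<and> i = 1 \<and> j \<noteq> 1"
      by (rule ext, unfold LL) (use that in \<open>simp add: algebra_simps\<close>)
    show "?K (Inl i) (Inl j) = (\<lambda>\<xi>. of_int (j - 1) * eps1 j \<xi>)"
      if "m \<noteq> 0 \<and> i = m + 1 \<and> j \<noteq> 1 \<and> j \<noteq> m + 1"
      by (rule ext, unfold LL) (use that in \<open>simp add: algebra_simps\<close>)
    show "?K (Inl i) (Inl j) = (\<lambda>\<xi>. 0)" if "i \<notin> {1, m + 1} \<and> j \<notin> {1, m + 1}"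
      by (rule ext, unfold LL) (use that in simp)
    show "?K (Inl i) (Inl j) = (\<lambda>\<xi>. 0)" if "m = 0 \<and> i = 1"
      by (rule ext, unfold LL) (use that in \<open>simp add: algebra_simps\<close>)
    show "?K (Inl i) (Inr j) =
        (if i = 1 \<and> m \<noteq> 0 then
           (\<lambda>\<xi>. of_int m * q * eps1 (j - m + 1) \<xi> - of_int (j - m) * eps2 (j - m) \<xi>)
         else if i = m + 1 \<and> j = m then
           (\<lambda>\<xi>. - of_int m * q * eps1 (m + 1) \<xi> + of_int m * eps2 m \<xi>)
         else if i = m + 1 \<and> j \<noteq> m \<and> m \<noteq> 0 then
           (\<lambda>\<xi>. of_int j * eps2 j \<xi>)
         else if i \<notin> {1, m + 1} \<and> j = m then
           (\<lambda>\<xi>. of_int (1 - i) * q * eps1 i \<xi>)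
         else (\<lambda>\<xi>. 0))"
      by (rule ext, unfold LR) (cases "i = 1"; cases "i = m + 1"; cases "j = m"; cases "m = 0"; simp)
    show "?K (Inr i) (Inr j) = (\<lambda>\<xi>. of_int j * q * eps2 j \<xi>)" if "i = m \<and> j \<noteq> m"
      by (rule ext, unfold RR) (use that in simp)
    show "?K (Inr i) (Inr j) = (\<lambda>\<xi>. 0)" if "i \<noteq> m \<and> j \<noteq> m"
      by (rule ext, unfold RR) (use that in simp)
  qed
qed

text \<open>
  Every entry of the table is prescribed directly, or after exchanging the indices, or lies on the
  diagonal, where skew-symmetry forces it to vanish in characteristic zero.
\<close>

lemma bracket_table_unique:
  fixes q :: "'k::field_char_0"
  assumes c: "\<And>a b \<xi>. c a b \<xi> = - c b a \<xi>" "bracket_table m q c"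
    and d: "\<And>a b \<xi>. d a b \<xi> = - d b a \<xi>" "bracket_table m q d"
  shows "c a b = d a b"
proof -
  have diag: "c a a = d a a" for a
  proof
    fix \<xi>
    have "c a a \<xi> + c a a \<xi> = 0" "d a a \<xi> + d a a \<xi> = 0"
      using c(1)[of a a \<xi>] d(1)[of a a \<xi>] by (simp_all only: eq_neg_iff_add_eq_0)
    then show "c a a \<xi> = d a a \<xi>" by (simp flip: mult_2)
  qed
  have swap: "c a b = d a b" if "c b a = d b a" for a b
    using c(1)[of a b] d(1)[of a b] that by (simp add: fun_eq_iff)
  note ct = c(2)[unfolded bracket_table_def] and dt = d(2)[unfolded bracket_table_def]
  have LL: "c (Inl i) (Inl j) = d (Inl i) (Inl j)" for i j
  proof -
    have row: "c (Inl i) (Inl j) = d (Inl i) (Inl j)" if "i = 1 \<or> (i = m + 1 \<and> j \<noteq> 1) \<or> (i \<notin> {1, m + 1} \<and> j \<notin> {1, m + 1})" for i j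
    proof (cases "i = j")
      case False
      then show ?thesis using that ct[THEN conjunct1, rule_format, of i j] dt[THEN conjunct1, rule_format, of i j]
        by (cases "m = 0") auto
    qed (simp add: diag)
    show ?thesis using row[of i j] row[of j i] swap[of "Inl j" "Inl i"] by blast
  qed
  have LR: "c (Inl i) (Inr j) = d (Inl i) (Inr j)" for i j
    using ct[THEN conjunct2, THEN conjunct1, rule_format, of i j]
      dt[THEN conjunct2, THEN conjunct1, rule_format, of i j] by (simp only:)
  have RR: "c (Inr i) (Inr j) = d (Inr i) (Inr j)" for i j
  proof -
    have row: "c (Inr i) (Inr j) = d (Inr i) (Inr j)" if "j \<noteq> m" for i j
      using that ct[THEN conjunct2, THEN conjunct2, rule_format, of i j]
        dt[THEN conjunct2, THEN conjunct2, rule_format, of i j] by auto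
    show ?thesis using row[of i j] row[of j i] swap[of "Inr j" "Inr i"] diag[of "Inr i"] by blast
  qed
  show ?thesis by (cases a; cases b) (auto simp: LL LR RR intro: swap)
qed

theorem theorem3p7:
  fixes m :: int and q :: "'k::{alg_closed_field, field_char_0}"
  shows "coboundary_triangular hv_scale hv_bracket (hv_r m q) \<and>
    (hv_circ :: ('k hv \<Rightarrow> 'k) set) = {pair_dual f g |f g. f \<in> laurent_circ \<and> g \<in> laurent_circ} \<and>
    (\<exists>br \<Delta>. dual_lie_bialgebra (coboundary hv_scale hv_bracket (hv_r m q)) br \<Delta> \<and>
      (\<forall>p \<xi> \<eta>. termwise_sum
          (\<lambda>(i, j). of_int (j - i) * (eps1 i \<xi> * eps1 j \<eta>)) {(i, j). i + j = p + 1}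
          (bracket_dual (eps1 p :: 'k hv \<Rightarrow> 'k) \<xi> \<eta>)) \<and>
      (\<forall>p \<xi> \<eta>. termwise_sum
          (\<lambda>(i, j). of_int j * (eps1 i \<xi> * eps2 j \<eta>) - of_int i * (eps2 i \<xi> * eps1 j \<eta>))
          {(i, j). i + j = p + 1}
          (bracket_dual (eps2 p :: 'k hv \<Rightarrow> 'k) \<xi> \<eta>)) \<and>
      (\<forall>f\<in>hv_circ. \<forall>\<xi> \<eta>. termwise_sum
          (\<lambda>a. f (hv_mon a) * bracket_dual (hv_eps a) \<xi> \<eta>) UNIV
          (eval_tensor (\<Delta> f) \<xi> \<eta>)) \<and>
      (\<forall>c. (\<forall>a b \<xi>. c a b \<xi> = - c b a \<xi>) \<and> bracket_table m q c \<longleftrightarrow>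
          c = (\<lambda>a b. cobracket_dual (coboundary hv_scale hv_bracket (hv_r m q))
                        (hv_eps a) (hv_eps b))) \<and>
      (\<forall>f\<in>hv_circ. \<forall>h\<in>hv_circ. \<forall>\<xi>. termwise_sum
          (\<lambda>(a, b). f (hv_mon a) * h (hv_mon b) *
             cobracket_dual (coboundary hv_scale hv_bracket (hv_r m q)) (hv_eps a) (hv_eps b) \<xi>) UNIV
          (br f h \<xi>)))"
proof -
  let ?\<delta> = "coboundary hv_scale hv_bracket (hv_r m q)"
  let ?br = "cobracket_dual ?\<delta>"
  let ?H = "hv_recurrent :: ('k hv \<Rightarrow> 'k) set"
  have form: "hv_form f" if "f \<in> ?H" for f using that by (simp add: hv_recurrent_def)
  have "\<exists>t. t \<in> tensor_square dual_scale ?H \<and> eval_tensor t = bracket_dual f" if "f \<in> ?H" for f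
    using good_subspace_hv_recurrent that unfolding good_subspace_def by blast
  then obtain \<Delta> where \<Delta>: "\<And>f. f \<in> ?H \<Longrightarrow> \<Delta> f \<in> tensor_square dual_scale ?H"
    "\<And>f. f \<in> ?H \<Longrightarrow> eval_tensor (\<Delta> f) = bracket_dual f"
    by metis
  have tri: "coboundary_triangular hv_scale hv_bracket (hv_r m q)" by (rule coboundary_triangular_hv)
  then have bi: "lie_bialgebra hv_scale UNIV hv_bracket ?\<delta>" by (simp add: coboundary_triangular_def)
  have "lie_bialgebra dual_scale ?H ?br \<Delta>"
    by (rule lie_bialgebra_dual[OF bi _ subspace_hv_recurrent form cobracket_dual_hv_recurrent])
      (auto simp: \<Delta> bracket_dual_def fun_eq_iff)
  then have dual: "dual_lie_bialgebra ?\<delta> ?br \<Delta>"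
    by (simp add: dual_lie_bialgebra_def hv_circ_eq_recurrent \<Delta>(2))
  have skew: "?br (hv_eps a) (hv_eps b) \<xi> = - ?br (hv_eps b) (hv_eps a) \<xi>" for a b \<xi>
    unfolding cobracket_dual_hv_r[OF hv_form_eps hv_form_eps] by (simp add: algebra_simps)
  have table: "(\<forall>a b \<xi>. c a b \<xi> = - c b a \<xi>) \<and> bracket_table m q c
    \<longleftrightarrow> c = (\<lambda>a b. ?br (hv_eps a) (hv_eps b))" for c
  proof
    assume "(\<forall>a b \<xi>. c a b \<xi> = - c b a \<xi>) \<and> bracket_table m q c"
    then show "c = (\<lambda>a b. ?br (hv_eps a) (hv_eps b))"
      by (intro ext[of c] ext[of "c _"] bracket_table_unique[OF _ _ skew bracket_table_hv]) blast+
  next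
    assume "c = (\<lambda>a b. ?br (hv_eps a) (hv_eps b))"
    then show "(\<forall>a b \<xi>. c a b \<xi> = - c b a \<xi>) \<and> bracket_table m q c"
      using skew bracket_table_hv by blast
  qed
  show ?thesis
  proof (intro conjI exI allI ballI)
    show "(hv_circ :: ('k hv \<Rightarrow> 'k) set) = {pair_dual f g |f g. f \<in> laurent_circ \<and> g \<in> laurent_circ}"
      unfolding hv_circ_eq_recurrent by (rule hv_recurrent_eq)
    show "termwise_sum (\<lambda>a. f (hv_mon a) * bracket_dual (hv_eps a) \<xi> \<eta>) UNIV (eval_tensor (\<Delta> f) \<xi> \<eta>)"
      if "f \<in> hv_circ" for f \<xi> \<eta>
      using that bracket_dual_termwise[OF form] unfolding hv_circ_eq_recurrent by (simp add: \<Delta>(2))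
    show "termwise_sum (\<lambda>(a, b). f (hv_mon a) * h (hv_mon b) * ?br (hv_eps a) (hv_eps b) \<xi>) UNIV (?br f h \<xi>)"
      if "f \<in> hv_circ" "h \<in> hv_circ" for f h \<xi>
      using that unfolding hv_circ_eq_recurrent by (intro cobracket_dual_termwise form)
  qed (fact tri dual table bracket_dual_eps1_termwise bracket_dual_eps2_termwise)+
qed

end
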